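(* Let $L>0$ and $\tau,\xi>-1$. Consider a random quadratic problem whose expected spectral distribution is $\nu_{\tau,\xi}$, a distribution on $(0,L]$ with edge exponents $(\tau,\xi)$ as described in the context. Then the optimal (over all oblivious first-order methods) asymptotic average-case rates, as $t\to\infty$, are $$\mathbb{E}[f(x_t)-f(x^\star)]=\Theta(t^{-2(\xi+2)}),\qquad \mathbb{E}[\|\nabla f(x_t)\|_2^2]=\Theta(t^{-2(\xi+3)}),$$ and they are attained by the Generalized Chebyshev Method with parameters $(\alpha,\beta)=(\tau,\xi+2)$ and $(\alpha,\beta)=(\tau,\xi+3)$, respectively. That is, the infimum over oblivious first-order methods of $\mathbb{E}[f(x_t)-f(x^\star)]$ is $\Theta(t^{-2(\xi+2)})$ and the Generalized Chebyshev Method with parameters $(\tau,\xi+2)$ satisfies $\mathbb{E}[f(x_t)-f(x^\star)]=\Theta(t^{-2(\xi+2)})$; and the infimum over oblivious first-order methods of $\mathbb{E}[\|\nabla f(x_t)\|_2^2]$ is $\Theta(t^{-2(\xi+3)})$ and the Generalized Chebyshev Method with parameters $(\tau,\xi+3)$ satisfies $\mathbb{E}[\|\nabla f(x_t)\|_2^2]=\Theta(t^{-2(\xi+3)})$.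
   Context: Random quadratic problem: $H\in\mathbb{R}^{d\times d}$ ($d$ fixed) is a random symmetric positive-definite matrix, $x^\star,x_0\in\mathbb{R}^d$ are random vectors with $x_0-x^\star$ independent of $H$ and $\mathbb{E}[(x_0-x^\star)(x_0-x^\star)^\top]=I$, and $f(x)=\tfrac12(x-x^\star)^\top H(x-x^\star)$. Expectations are over $H,x_0,x^\star$. Constants hidden in $\Theta$ do not depend on $t$ but may depend on the problem distribution. Expected spectral distribution (ESD): if $\lambda_1,\dots,\lambda_d$ are the eigenvalues of $H$, set $\mu_H=\frac1d\sum_{i=1}^d\delta_{\lambda_i}$; the ESD is the probability measure $\mathbb{E}_H[\mu_H]$. Edge assumption on $\nu_{\tau,\xi}$: $\nu_{\tau,\xi}$ is a probability distribution supported in $(0,L]$ with density $\nu_{\tau,\xi}'$ with respect to Lebesgue measure, $\nu_{\tau,\xi}'(\lambda)>0$ for $\lambda\in(0,L)$, $\nu_{\tau,\xi}'(\lambda)=\Theta(\lambda^\xi)$ as $\lambda\to0^+$ and $\nu_{\tau,\xi}'(\lambda)=\Theta((L-\lambda)^\tau)$ as $\lambda\to L^-$. Oblivious first-order method: a method with $x_t\in x_0+\mathrm{span}\{\nabla f(x_0),\dots,\nabla f(x_{t-1})\}$ whose update coefficients are fixed in advance (they do not depend on the realization of the problem or on previous iterates). Equivalently, $x_t-x^\star=P_t(H)(x_0-x^\star)$ for a fixed real polynomial $P_t$ of degree at most $t$ with $P_t(0)=1$ (a residual polynomial). Generalized Chebyshev Method with parameters $(\alpha,\beta)$, $\alpha,\beta>-1$,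 and scale $L$: the first-order method with $x_t-x^\star=P_t^{\alpha,\beta}(H)(x_0-x^\star)$, where $P_t^{\alpha,\beta}$ is the polynomial of degree $t$ with $P_t^{\alpha,\beta}(0)=1$, and $(P_t^{\alpha,\beta})_{t\ge0}$ are orthogonal on $[0,L]$ with respect to the weight $\lambda^\beta(L-\lambda)^\alpha\,d\lambda$ (shifted Jacobi polynomials normalized at $0$). *)

theory Defs
  imports
    "HOL-Probability.Probability"
    "HOL-Computational_Algebra.Computational_Algebra"
    "HOL-Library.Landau_Symbols"
begin

section \<open>Matrices\<close>

definition sym_pos_def :: "real ^ 'n ^ 'n \<Rightarrow> bool" where
  "sym_pos_def A \<longleftrightarrow> transpose A = A \<and> (\<forall>v. v \<noteq> 0 \<longrightarrow> 0 < v \<bullet> (A *v v))"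

definition charpoly :: "real ^ 'n ^ 'n \<Rightarrow> real poly" where
  "charpoly A = det (\<chi> i j. (if i = j then [:0, 1:] else 0) - [:A $ i $ j:])"

text \<open>Real eigenvalues, repeated according to algebraic multiplicity; for symmetric matrices
  these are all \<open>CARD('n)\<close> eigenvalues.\<close>

definition eigenvalues :: "real ^ 'n ^ 'n \<Rightarrow> real multiset" where
  "eigenvalues A = proots (charpoly A)"

text \<open>\<open>poly\<close> cannot be used here because multiplication on the type of matrices is not the
  matrix product \<open>**\<close>.\<close>

definition poly_matrix :: "real poly \<Rightarrow> real ^ 'n ^ 'n \<Rightarrow> real ^ 'n ^ 'n" where
  "poly_matrix p A = (\<Sum>i\<le>degree p. coeff p i *\<^sub>R (((**) A) ^^ i) (mat 1))"


section \<open>Random quadratic problems\<close>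

definition quadratic :: "real ^ 'n ^ 'n \<Rightarrow> real ^ 'n \<Rightarrow> real ^ 'n \<Rightarrow> real" where
  "quadratic A xs x = (1 / 2) * ((x - xs) \<bullet> (A *v (x - xs)))"

text \<open>Independence is stated through the generated events, as in \<open>indep_var_eq\<close>, because
  \<open>indep_var\<close> forces both random variables to take values in the same type.\<close>

locale random_quadratic_problem = prob_space M
  for M :: "'w measure"
    and H :: "'w \<Rightarrow> real ^ 'n ^ 'n" and x0 xs :: "'w \<Rightarrow> real ^ 'n" +
  assumes measurable_H: "H \<in> borel_measurable M"
    and measurable_x0: "x0 \<in> borel_measurable M"
    and measurable_xs: "xs \<in> borel_measurable M"
    and sym_pos_def_H: "\<And>\<omega>. \<omega> \<in> space M \<Longrightarrow> sym_pos_def (H \<omega>)"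
    and indep: "indep_set {(\<lambda>\<omega>. x0 \<omega> - xs \<omega>) -` B \<inter> space M | B. B \<in> sets borel}
                          {H -` B \<inter> space M | B. B \<in> sets borel}"
    and second_moment: "has_bochner_integral M
          (\<lambda>\<omega>. \<chi> i j. (x0 \<omega> - xs \<omega>) $ i * (x0 \<omega> - xs \<omega>) $ j) (mat 1)"


section \<open>Expected spectral distribution\<close>

text \<open>The uniform distribution on the eigenvalues counted with multiplicity, that is,
  \<open>(1/d) \<Sum>i. \<delta>(\<lambda>\<^sub>i)\<close>, as a measure on the Borel sets.\<close>

definition spectral_measure :: "real ^ 'n ^ 'n \<Rightarrow> real measure" where
  "spectral_measure A = distr (measure_pmf (pmf_of_multiset (eigenvalues A))) borel (\<lambda>x. x)"

text \<open>The mean of the random measure is its Giry-monad mixture, the measure with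
  \<open>B \<mapsto> \<integral>\<^sup>+\<omega>. emeasure (spectral_measure (H \<omega>)) B \<partial>M\<close>.\<close>

definition expected_spectral_distribution ::
    "'w measure \<Rightarrow> ('w \<Rightarrow> real ^ 'n ^ 'n) \<Rightarrow> real measure" where
  "expected_spectral_distribution M H = M \<bind> (\<lambda>\<omega>. spectral_measure (H \<omega>))"

text \<open>\<open>\<tau>\<close> is the exponent at the right edge \<open>L\<close> and \<open>\<xi>\<close> the exponent at the left edge \<open>0\<close>.\<close>

definition edge_distribution :: "real \<Rightarrow> real \<Rightarrow> real \<Rightarrow> real measure \<Rightarrow> bool" where
  "edge_distribution L \<tau> \<xi> \<nu> \<longleftrightarrow>
     prob_space \<nu> \<and> (AE x in \<nu>. x \<in> {0<..L}) \<and>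
     (\<exists>\<nu>' :: real \<Rightarrow> real.
        \<nu>' \<in> borel_measurable borel \<and> (\<forall>x. 0 \<le> \<nu>' x) \<and>
        \<nu> = density lborel (\<lambda>x. ennreal (\<nu>' x)) \<and>
        (\<forall>x\<in>{0<..<L}. 0 < \<nu>' x) \<and>
        \<nu>' \<in> \<Theta>[at_right 0](\<lambda>x. x powr \<xi>) \<and>
        \<nu>' \<in> \<Theta>[at_left L](\<lambda>x. (L - x) powr \<tau>))"


section \<open>Oblivious first-order methods\<close>

definition gradient :: "('a::real_inner \<Rightarrow> real) \<Rightarrow> 'a \<Rightarrow> 'a" where
  "gradient f x = (THE D. GDERIV f x :> D)"

text \<open>An oblivious method is given by its coefficient array \<open>c\<close>, fixed independently of the
  objective and the starting point; only the entries \<open>c t s\<close> with \<open>s < t\<close> matter.\<close>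

fun iterate ::
    "(nat \<Rightarrow> nat \<Rightarrow> real) \<Rightarrow> ('a::real_inner \<Rightarrow> real) \<Rightarrow> 'a \<Rightarrow> nat \<Rightarrow> 'a" where
  "iterate c f y0 t = y0 + (\<Sum>s\<in>{..<t}. c t s *\<^sub>R gradient f (iterate c f y0 s))"

declare iterate.simps [simp del]

definition expected_gap ::
    "'w measure \<Rightarrow> ('w \<Rightarrow> real ^ 'n ^ 'n) \<Rightarrow> ('w \<Rightarrow> real ^ 'n) \<Rightarrow> ('w \<Rightarrow> real ^ 'n)
     \<Rightarrow> (nat \<Rightarrow> nat \<Rightarrow> real) \<Rightarrow> nat \<Rightarrow> real" where
  "expected_gap M H x0 xs c t =
     (\<integral>\<omega>. quadratic (H \<omega>) (xs \<omega>) (iterate c (quadratic (H \<omega>) (xs \<omega>)) (x0 \<omega>) t)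
         - quadratic (H \<omega>) (xs \<omega>) (xs \<omega>) \<partial>M)"

definition expected_sq_grad ::
    "'w measure \<Rightarrow> ('w \<Rightarrow> real ^ 'n ^ 'n) \<Rightarrow> ('w \<Rightarrow> real ^ 'n) \<Rightarrow> ('w \<Rightarrow> real ^ 'n)
     \<Rightarrow> (nat \<Rightarrow> nat \<Rightarrow> real) \<Rightarrow> nat \<Rightarrow> real" where
  "expected_sq_grad M H x0 xs c t =
     (\<integral>\<omega>. (norm (gradient (quadratic (H \<omega>) (xs \<omega>))
              (iterate c (quadratic (H \<omega>) (xs \<omega>)) (x0 \<omega>) t)))\<^sup>2 \<partial>M)"


section \<open>Generalized Chebyshev Method\<close>

definition shifted_jacobi :: "real \<Rightarrow> real \<Rightarrow> real \<Rightarrow> (nat \<Rightarrow> real poly) \<Rightarrow> bool" where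
  "shifted_jacobi L \<alpha> \<beta> P \<longleftrightarrow>
     (\<forall>t. degree (P t) = t \<and> poly (P t) 0 = 1) \<and>
     (\<forall>s t. s \<noteq> t \<longrightarrow>
        (LINT x:{0..L}|lborel. poly (P s) x * poly (P t) x * (x powr \<beta> * (L - x) powr \<alpha>)) = 0)"

text \<open>The coefficients \<open>c\<close> implement the method: on every (deterministic) symmetric
  positive-definite quadratic in dimension \<open>CARD('n)\<close> the error is \<open>P\<^sub>t(A) (y0 - ys)\<close>.\<close>

definition generalized_chebyshev_method ::
    "'n::finite itself \<Rightarrow> real \<Rightarrow> real \<Rightarrow> real \<Rightarrow> (nat \<Rightarrow> nat \<Rightarrow> real) \<Rightarrow> bool" where
  "generalized_chebyshev_method _ L \<alpha> \<beta> c \<longleftrightarrow>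
     (\<exists>P. shifted_jacobi L \<alpha> \<beta> P \<and>
        (\<forall>(A :: real ^ 'n ^ 'n) ys y0 t. sym_pos_def A \<longrightarrow>
           iterate c (quadratic A ys) y0 t - ys = poly_matrix (P t) A *v (y0 - ys)))"

end

theory Submission
  imports Defs
begin

text \<open>By the spectral theorem and the independence of \<open>H\<close> and \<open>x\<^sub>0 - x\<^sup>\<star>\<close>, the two performance measures of a method
  with residual polynomials \<open>P\<^sub>t\<close> are \<open>(d/2) \<integral> x P\<^sub>t\<^sup>2 d\<nu>\<close> and \<open>d \<integral> x\<^sup>2 P\<^sub>t\<^sup>2 d\<nu>\<close>. Put \<open>\<beta> = \<xi> + k + 1\<close>
  with \<open>k\<close> the power of \<open>x\<close>. Orthogonality of \<open>P\<^sub>t\<close> to lower degrees for the weight \<open>x\<^sup>\<beta> (L - x)\<^sup>\<alpha>\<close> says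
  that \<open>P\<^sub>t\<close> minimises \<open>\<integral> P\<^sup>2 x\<^bsup>\<beta>-1\<^esup> (L - x)\<^sup>\<alpha> dx\<close> subject to \<open>P(0) = 1\<close>; the minimum has a closed form of
  order \<open>t\<^bsup>-2\<beta>\<^esup>\<close>.

  Lower bound: near \<open>0\<close> the density dominates \<open>x\<^sup>\<xi>\<close>, so the minimum for \<open>\<alpha> = 0\<close> on a short interval
  \<open>[0, \<epsilon>]\<close> applies. Upper bound for \<open>\<alpha> = \<tau>\<close>: near both ends \<open>x\<^sup>k d\<nu>\<close> is dominated by the weight
  \<open>x\<^bsup>\<beta>-1\<^esup> (L - x)\<^sup>\<tau> dx\<close>. In the interior the density may be unbounded, but there \<open>P\<^sub>t\<^sup>2\<close> is bounded
  pointwise by a multiple of its weighted mean (Sonin's function), hence also of order \<open>t\<^bsup>-2\<beta>\<^esup>\<close>.\<close>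

section \<open>Jacobi polynomials on \<open>[0, L]\<close>\<close>

text \<open>The lower and the upper bound meet although one uses the exponent 0 on a short interval
  and the other \<open>\<tau>\<close> on \<open>[0, L]\<close>: in the closed form, a quotient of
  Pochhammer symbols, the powers of t due to \<open>\<alpha>\<close> cancel and the length of the
  interval enters only the constant. The rate thus depends on the left edge alone;
  \<open>\<alpha> = \<tau>\<close> is the choice for which the weight dominates the density at the
  right edge. The obstacle to the upper bound is the interior. The density is controlled only near
  the edges and may exceed every multiple of the weight in between, so only its total mass is
  available there; hence the need for a bound on the square of the polynomial that holds at every
  interior point. In the probabilistic part no measurable choice of eigenvectors is made.
  Expectations are taken of entries and traces of polynomials in \<open>H\<close>, which are
  continuous in \<open>H\<close>; an eigenbasis appears only for a fixed outcome. The infimum over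
  coefficient arrays is squeezed between a lower bound uniform over all residual polynomials of
  degree at most t and one explicit array.\<close>

definition jacobi_integral :: "real \<Rightarrow> real \<Rightarrow> real \<Rightarrow> real poly \<Rightarrow> real" where
  "jacobi_integral L \<alpha> \<beta> q = (LINT x:{0..L}|lborel. poly q x * (x powr \<beta> * (L - x) powr \<alpha>))"

text \<open>The substitution \<open>x = L * t\<close> in Euler's Beta integral. The two powers
  release \<open>L powr (a + b - 2)\<close>, and the change of variable one more factor
  \<open>L\<close>.\<close>

lemma has_bochner_integral_Beta_scaled:
  fixes L a b :: real
  assumes "0 < L" "0 < a" "0 < b"
  shows "has_bochner_integral lborel
           (\<lambda>x. indicator {0..L} x *\<^sub>R (x powr (a - 1) * (L - x) powr (b - 1)))
           (L powr (a + b - 1) * Beta a b)"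
proof -
  let ?g = "\<lambda>t::real. indicator {0..1} t *\<^sub>R (t powr (a - 1) * (1 - t) powr (b - 1))"
  have int: "set_integrable lborel {0..1} (\<lambda>t. t powr (a - 1) * (1 - t) powr (b - 1))"
    by (rule integrable_Beta[OF assms(2,3)])
  have "(LINT t:{0..1}|lborel. t powr (a - 1) * (1 - t) powr (b - 1)) = Beta a b"
    using set_borel_integral_eq_integral(2)[OF int] has_integral_Beta_real[OF assms(2,3)]
    by (simp add: integral_unique)
  then have "has_bochner_integral lborel ?g (Beta a b)"
    using int by (simp add: has_bochner_integral_iff set_integrable_def set_lebesgue_integral_def)
  then have "has_bochner_integral lborel (\<lambda>x. ?g (0 + (1 / L) * x)) (Beta a b /\<^sub>R \<bar>1 / L\<bar>)"
    using lborel_has_bochner_integral_real_affine_iff[of "1 / L" ?g "Beta a b" 0] assms by simp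
  then have "has_bochner_integral lborel (\<lambda>x. L powr (a + b - 2) * ?g (0 + (1 / L) * x))
     (L powr (a + b - 2) * (Beta a b /\<^sub>R \<bar>1 / L\<bar>))"
    by (intro has_bochner_integral_mult_right) auto
  moreover have "L powr (a + b - 2) * ?g (0 + (1 / L) * x)
      = indicator {0..L} x *\<^sub>R (x powr (a - 1) * (L - x) powr (b - 1))" for x
  proof (cases "x \<in> {0..L}")
    case True
    then have 1: "x = L * (x / L)" "L - x = L * (1 - x / L)" and 2: "0 \<le> x / L" "0 \<le> 1 - x / L"
      using assms by (auto simp: field_simps)
    have "x powr (a - 1) * (L - x) powr (b - 1)
      = L powr (a - 1) * L powr (b - 1) * ((x / L) powr (a - 1) * (1 - x / L) powr (b - 1))"
      using 2 assms by (subst 1(1), subst 1(2), subst (1 2) powr_mult) auto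
    also have "L powr (a - 1) * L powr (b - 1) = L powr (a + b - 2)"
      by (simp add: powr_add[symmetric] algebra_simps)
    finally show ?thesis using True assms by (simp add: field_simps)
  next
    case False
    then have "x / L \<notin> {0..1}" using assms by (auto simp: field_simps)
    then show ?thesis using False by simp
  qed
  moreover have "L powr (a + b - 2) * (Beta a b /\<^sub>R \<bar>1 / L\<bar>) = L powr (a + b - 1) * Beta a b"
  proof -
    have "L powr (a + b - 2) * L powr 1 = L powr (a + b - 1)"
      by (simp only: powr_add[symmetric]) (simp add: algebra_simps)
    then show ?thesis using assms by (simp add: field_simps)
  qed
  ultimately show ?thesis by (simp only:)
qed

section \<open>Integration of polynomials against the Jacobi weight\<close>

context
  fixes L \<alpha> \<beta> :: real
  assumes L: "0 < L" and \<alpha>: "-1 < \<alpha>" and \<beta>: "-1 < \<beta>"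
begin

lemma set_integrable_jacobi_monom:
  "set_integrable lborel {0..L} (\<lambda>x. x ^ k * (x powr \<beta> * (L - x) powr \<alpha>))"
  and jacobi_integral_monom_one:
  "(LINT x:{0..L}|lborel. x ^ k * (x powr \<beta> * (L - x) powr \<alpha>))
     = L powr (\<alpha> + \<beta> + k + 1) * Beta (\<beta> + k + 1) (\<alpha> + 1)"
proof -
  \<comment> \<open>At \<open>x = 0\<close> both sides vanish, even for \<open>k = 0\<close>,
    because \<open>0 powr s = 0\<close> for every \<open>s\<close>.\<close>
  have *: "indicator {0..L} x *\<^sub>R (x ^ k * (x powr \<beta> * (L - x) powr \<alpha>))
     = indicator {0..L} x *\<^sub>R (x powr ((\<beta> + k + 1) - 1) * (L - x) powr ((\<alpha> + 1) - 1))" for x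
  proof (cases "0 < x")
    case True
    then show ?thesis by (simp add: powr_add powr_realpow)
  next
    case False
    then show ?thesis by (cases "x = 0") auto
  qed
  have "has_bochner_integral lborel
           (\<lambda>x. indicator {0..L} x *\<^sub>R (x ^ k * (x powr \<beta> * (L - x) powr \<alpha>)))
           (L powr ((\<beta> + k + 1) + (\<alpha> + 1) - 1) * Beta (\<beta> + k + 1) (\<alpha> + 1))"
    unfolding * by (rule has_bochner_integral_Beta_scaled) (use L \<alpha> \<beta> in auto)
  then show "set_integrable lborel {0..L} (\<lambda>x. x ^ k * (x powr \<beta> * (L - x) powr \<alpha>))"
    and "(LINT x:{0..L}|lborel. x ^ k * (x powr \<beta> * (L - x) powr \<alpha>))
     = L powr (\<alpha> + \<beta> + k + 1) * Beta (\<beta> + k + 1) (\<alpha> + 1)"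
    by (auto simp: has_bochner_integral_iff set_integrable_def set_lebesgue_integral_def algebra_simps)
qed

lemma set_integrable_jacobi:
  "set_integrable lborel {0..L} (\<lambda>x. poly q x * (x powr \<beta> * (L - x) powr \<alpha>))"
proof -
  have "integrable lborel (\<lambda>x. \<Sum>k\<le>degree q. coeff q k *
      (indicator {0..L} x *\<^sub>R (x ^ k * (x powr \<beta> * (L - x) powr \<alpha>))))"
    using set_integrable_jacobi_monom unfolding set_integrable_def
    by (intro Bochner_Integration.integrable_sum integrable_mult_right) auto
  then show ?thesis
    by (simp add: set_integrable_def poly_altdef sum_distrib_right sum_distrib_left mult_ac)
qed

lemma jacobi_integral_add:
  "jacobi_integral L \<alpha> \<beta> (p + q) = jacobi_integral L \<alpha> \<beta> p + jacobi_integral L \<alpha> \<beta> q"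
  unfolding jacobi_integral_def
  by (simp add: ring_distribs set_integral_add(2) set_integrable_jacobi)

lemma jacobi_integral_smult:
  "jacobi_integral L \<alpha> \<beta> (smult c q) = c * jacobi_integral L \<alpha> \<beta> q"
  unfolding jacobi_integral_def by (simp add: mult.assoc)

lemma jacobi_integral_diff:
  "jacobi_integral L \<alpha> \<beta> (p - q) = jacobi_integral L \<alpha> \<beta> p - jacobi_integral L \<alpha> \<beta> q"
  using jacobi_integral_add[of p "smult (- 1) q"] jacobi_integral_smult[of "- 1" q] by simp

lemma jacobi_integral_0: "jacobi_integral L \<alpha> \<beta> 0 = 0"
  using jacobi_integral_smult[of 0 0] by simp

lemma jacobi_integral_sum:
  "jacobi_integral L \<alpha> \<beta> (sum f A) = (\<Sum>i\<in>A. jacobi_integral L \<alpha> \<beta> (f i))"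
  by (induction A rule: infinite_finite_induct) (auto simp: jacobi_integral_0 jacobi_integral_add)

lemma jacobi_integral_monom:
  "jacobi_integral L \<alpha> \<beta> (monom c k) = c * (L powr (\<alpha> + \<beta> + k + 1) * Beta (\<beta> + k + 1) (\<alpha> + 1))"
  using jacobi_integral_monom_one[of k] jacobi_integral_smult[of c "monom 1 k"]
  by (simp add: jacobi_integral_def poly_monom smult_monom)

lemma jacobi_integral_nonneg:
  "(\<And>x. 0 \<le> x \<Longrightarrow> x \<le> L \<Longrightarrow> 0 \<le> poly q x) \<Longrightarrow> 0 \<le> jacobi_integral L \<alpha> \<beta> q"
  unfolding jacobi_integral_def set_lebesgue_integral_def
  by (intro integral_nonneg_AE AE_I2) (auto simp: indicator_def)

text \<open>The weight satisfies the Pearson equation, so that the left-hand side integrates the derivative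
  of \<open>x\<^bsup>\<beta>+1\<^esup> (L - x)\<^bsup>\<alpha>+1\<^esup> q(x)\<close>.\<close>

lemma jacobi_integral_by_parts:
  "jacobi_integral L \<alpha> \<beta> ([:(\<beta> + 1) * L, - (\<alpha> + \<beta> + 2):] * q + [:0, L, -1:] * pderiv q) = 0"
proof -
  let ?A = "\<lambda>q. [:(\<beta> + 1) * L, - (\<alpha> + \<beta> + 2):] * q + [:0, L, -1:] * pderiv q"
  \<comment> \<open>By linearity it suffices to test monomials, where the identity is the recurrence
    of the Beta function in its first argument; this takes the place of boundary terms.\<close>
  have monom: "jacobi_integral L \<alpha> \<beta> (?A (monom c k)) = 0" for c k
  proof -
    have A: "?A (monom c k) = monom (c * L * (\<beta> + 1 + k)) k - monom (c * (\<alpha> + \<beta> + 2 + k)) (Suc k)"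
      by (rule poly_ext) (cases k, auto simp: poly_monom pderiv_monom algebra_simps)
    have "\<beta> + 1 + real k \<notin> \<int>\<^sub>\<le>\<^sub>0" using \<beta> by (auto elim!: nonpos_Ints_cases)
    then have Beta: "(\<alpha> + \<beta> + 2 + k) * Beta (\<beta> + 1 + Suc k) (\<alpha> + 1) = (\<beta> + 1 + k) * Beta (\<beta> + 1 + k) (\<alpha> + 1)"
      using Beta_plus1_left[of "\<beta> + 1 + k" "\<alpha> + 1"] by (simp add: algebra_simps)
    have L_powr: "L powr (\<alpha> + \<beta> + Suc k + 1) = L * L powr (\<alpha> + \<beta> + k + 1)"
      using L by (simp add: powr_add power2_eq_square)
    have "jacobi_integral L \<alpha> \<beta> (?A (monom c k)) = c * L * L powr (\<alpha> + \<beta> + k + 1) *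
        ((\<beta> + 1 + k) * Beta (\<beta> + 1 + k) (\<alpha> + 1) -
         (\<alpha> + \<beta> + 2 + k) * Beta (\<beta> + 1 + Suc k) (\<alpha> + 1))"
      unfolding A jacobi_integral_diff jacobi_integral_monom L_powr
      by (simp add: algebra_simps)
    then show ?thesis unfolding Beta by simp
  qed
  have "?A q = (\<Sum>k\<le>degree q. ?A (monom (coeff q k) k))"
  proof -
    have "?A q = ?A (\<Sum>k\<le>degree q. monom (coeff q k) k)"
      by (simp add: poly_as_sum_of_monoms)
    also have "\<dots> = (\<Sum>k\<le>degree q. ?A (monom (coeff q k) k))"
      unfolding higher_pderiv_sum[of 1, simplified] sum_distrib_left sum.distrib ..
    finally show ?thesis .
  qed
  then show ?thesis by (simp only: jacobi_integral_sum monom) simp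
qed

end

text \<open>The terminating Gauss series 2F1(-t, t + \<alpha> + \<beta> + 1; \<beta> + 1; x / L),
  which is the shifted Jacobi polynomial with value 1 at 0.\<close>

definition jacobi_poly :: "real \<Rightarrow> real \<Rightarrow> real \<Rightarrow> nat \<Rightarrow> real poly" where
  "jacobi_poly L \<alpha> \<beta> t =
     (\<Sum>k\<le>t. monom ((-1) ^ k * real (t choose k) * pochhammer (t + \<alpha> + \<beta> + 1) k
                     / (pochhammer (\<beta> + 1) k * L ^ k)) k)"

lemma coeff_jacobi_poly:
  "coeff (jacobi_poly L \<alpha> \<beta> t) k =
     (-1) ^ k * real (t choose k) * pochhammer (t + \<alpha> + \<beta> + 1) k / (pochhammer (\<beta> + 1) k * L ^ k)"
proof -
  let ?c = "\<lambda>k. (-1) ^ k * real (t choose k) * pochhammer (t + \<alpha> + \<beta> + 1) k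
                     / (pochhammer (\<beta> + 1) k * L ^ k)"
  have "coeff (jacobi_poly L \<alpha> \<beta> t) k = (\<Sum>i\<le>t. if i = k then ?c i else 0)"
    unfolding jacobi_poly_def coeff_sum by (simp add: coeff_monom)
  also have "\<dots> = (if k \<le> t then ?c k else 0)" by (simp add: sum.delta)
  also have "\<dots> = ?c k" by (simp add: binomial_eq_0)
  finally show ?thesis .
qed

lemma poly_jacobi_poly_0: "poly (jacobi_poly L \<alpha> \<beta> t) 0 = 1"
  by (simp add: poly_0_coeff_0 coeff_jacobi_poly)

lemma degree_jacobi_poly:
  assumes "0 < L" "-1 < \<alpha>" "-1 < \<beta>"
  shows "degree (jacobi_poly L \<alpha> \<beta> t) = t"
proof (rule antisym)
  show "degree (jacobi_poly L \<alpha> \<beta> t) \<le> t"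
    by (rule degree_le) (simp add: coeff_jacobi_poly binomial_eq_0)
  have "pochhammer (\<beta> + 1) t > 0" using assms by (intro pochhammer_pos) auto
  \<comment> \<open>For \<open>t = 0\<close> the base \<open>\<alpha> + \<beta> + 1\<close> may be
    nonpositive, but then the product is empty.\<close>
  moreover have "pochhammer (t + \<alpha> + \<beta> + 1) t > 0"
    by (cases "t = 0") (use assms in \<open>auto intro!: pochhammer_pos\<close>)
  ultimately have "coeff (jacobi_poly L \<alpha> \<beta> t) t \<noteq> 0"
    using assms by (simp add: coeff_jacobi_poly)
  then show "t \<le> degree (jacobi_poly L \<alpha> \<beta> t)" by (rule le_degree)
qed

section \<open>The Jacobi differential equation and orthogonality\<close>

context
  fixes L \<alpha> \<beta> :: real
  assumes L: "0 < L" and \<alpha>: "-1 < \<alpha>" and \<beta>: "-1 < \<beta>"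
begin

text \<open>The term ratio of the hypergeometric series with denominators cleared; the factor that
  vanishes at \<open>k = t\<close> comes from the binomial coefficient.\<close>

lemma coeff_jacobi_poly_Suc:
  "L * (real k + 1) * (k + \<beta> + 1) * coeff (jacobi_poly L \<alpha> \<beta> t) (Suc k)
     = (real k - real t) * (real k + real t + \<alpha> + \<beta> + 1) * coeff (jacobi_poly L \<alpha> \<beta> t) k"
proof -
  have pos: "pochhammer (\<beta> + 1) k > 0" "k + \<beta> + 1 > 0"
    using \<beta> by (auto intro!: pochhammer_pos)
  have choose: "(real k + 1) * real (t choose Suc k) = (real t - real k) * real (t choose k)"
  proof (cases "k \<le> t")
    case True
    then show ?thesis using binomial_absorb_comp[of t k] binomial_absorption[of k "t"]
      by (metis Suc_eq_plus1 binomial_absorb_comp binomial_absorption mult.commute of_nat_Suc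
          of_nat_diff of_nat_mult times_binomial_minus1_eq add.commute)
  qed (simp add: binomial_eq_0)
  define c where "c = (-1) ^ k * pochhammer (t + \<alpha> + \<beta> + 1) k / (pochhammer (\<beta> + 1) k * L ^ k)"
  have "coeff (jacobi_poly L \<alpha> \<beta> t) (Suc k)
      = - (c * (real k + real t + \<alpha> + \<beta> + 1) * real (t choose Suc k)) / ((k + \<beta> + 1) * L)"
    by (simp add: coeff_jacobi_poly pochhammer_Suc c_def mult_ac add_ac)
  then have "L * (real k + 1) * (k + \<beta> + 1) * coeff (jacobi_poly L \<alpha> \<beta> t) (Suc k)
    = - c * (real k + real t + \<alpha> + \<beta> + 1) * ((real k + 1) * real (t choose Suc k))"
    using pos(2) L by (simp add: mult_ac)
  also have "\<dots> = (real k - real t) * (real k + real t + \<alpha> + \<beta> + 1) * coeff (jacobi_poly L \<alpha> \<beta> t) k"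
  proof -
    have "coeff (jacobi_poly L \<alpha> \<beta> t) k = c * real (t choose k)"
      by (simp add: coeff_jacobi_poly c_def)
    then show ?thesis unfolding choose by (simp add: algebra_simps)
  qed
  finally show ?thesis .
qed

text \<open>The hypergeometric equation. Comparing coefficients of \<open>x ^ n\<close> gives
  exactly the two-term recurrence, since n(n - 1) + (\<alpha> + \<beta> + 2)n - t(t + \<alpha> +
  \<beta> + 1) = (n - t)(n + t + \<alpha> + \<beta> + 1).\<close>

lemma jacobi_poly_ode:
  fixes t :: nat
  defines "y \<equiv> jacobi_poly L \<alpha> \<beta> t"
  shows "[:0, L, -1:] * pderiv (pderiv y) + [:(\<beta> + 1) * L, - (\<alpha> + \<beta> + 2):] * pderiv y
           = smult (- (t * (t + \<alpha> + \<beta> + 1))) y"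
proof (rule poly_eqI)
  fix n
  have rec: "L * (real n + 1) * (n + \<beta> + 1) * coeff y (Suc n)
     = (real n - real t) * (real n + real t + \<alpha> + \<beta> + 1) * coeff y n"
    unfolding y_def by (rule coeff_jacobi_poly_Suc)
  have c1: "coeff ([:0, L, -1:] * pderiv (pderiv y)) n
      = L * n * (n + 1) * coeff y (Suc n) - n * (real n - 1) * coeff y n"
    by (cases n; cases "n - 1") (auto simp: coeff_pderiv coeff_pCons algebra_simps split: nat.splits)
  have c2: "coeff ([:(\<beta> + 1) * L, - (\<alpha> + \<beta> + 2):] * pderiv y) n
      = (\<beta> + 1) * L * (n + 1) * coeff y (Suc n) - (\<alpha> + \<beta> + 2) * n * coeff y n"
    by (cases n) (auto simp: coeff_pderiv coeff_pCons algebra_simps split: nat.splits)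
  show "coeff ([:0, L, -1:] * pderiv (pderiv y)
        + [:(\<beta> + 1) * L, - (\<alpha> + \<beta> + 2):] * pderiv y) n
      = coeff (smult (- (t * (t + \<alpha> + \<beta> + 1))) y) n"
    unfolding coeff_add coeff_smult c1 c2 using rec by (simp add: algebra_simps)
qed

text \<open>Weak form of the Jacobi equation, from integration by parts applied to
  \<open>pderiv y * z\<close>. With another Jacobi polynomial for \<open>z\<close> its symmetric
  right-hand side yields orthogonality; with \<open>z = y\<close> it evaluates the derivative term
  of Sonin's function.\<close>

lemma jacobi_integral_pderiv:
  fixes t :: nat
  defines "y \<equiv> jacobi_poly L \<alpha> \<beta> t"
  shows "t * (t + \<alpha> + \<beta> + 1) * jacobi_integral L \<alpha> \<beta> (y * z)
       = jacobi_integral L \<alpha> \<beta> ([:0, L, -1:] * pderiv y * pderiv z)"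
proof -
  have "[:(\<beta> + 1) * L, - (\<alpha> + \<beta> + 2):] * (pderiv y * z) + [:0, L, -1:] * pderiv (pderiv y * z)
    = ([:0, L, -1:] * pderiv (pderiv y) + [:(\<beta> + 1) * L, - (\<alpha> + \<beta> + 2):] * pderiv y) * z
       + [:0, L, -1:] * pderiv y * pderiv z"
    unfolding pderiv_mult by algebra
  also have "\<dots> = smult (- (t * (t + \<alpha> + \<beta> + 1))) (y * z) + [:0, L, -1:] * pderiv y * pderiv z"
    unfolding y_def jacobi_poly_ode by (simp only: mult_smult_left)
  finally have eq: "[:(\<beta> + 1) * L, - (\<alpha> + \<beta> + 2):] * (pderiv y * z)
      + [:0, L, -1:] * pderiv (pderiv y * z)
    = smult (- (t * (t + \<alpha> + \<beta> + 1))) (y * z) + [:0, L, -1:] * pderiv y * pderiv z" .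
  show ?thesis
    using jacobi_integral_by_parts[OF L \<alpha> \<beta>, of "pderiv y * z", unfolded eq
        jacobi_integral_add[OF L \<alpha> \<beta>] jacobi_integral_smult[OF L \<alpha> \<beta>]]
    by (simp only: mult_minus_left)
qed

text \<open>Eigenfunctions of a symmetric operator for different eigenvalues. The difference of the
  eigenvalues factors, and \<open>s + t \<ge> 1\<close> compensates for
  \<open>\<alpha> + \<beta> + 1\<close> being bounded below only by -1.\<close>

lemma jacobi_poly_orthogonal:
  assumes "s \<noteq> t"
  shows "jacobi_integral L \<alpha> \<beta> (jacobi_poly L \<alpha> \<beta> s * jacobi_poly L \<alpha> \<beta> t) = 0"
proof -
  let ?I = "jacobi_integral L \<alpha> \<beta> (jacobi_poly L \<alpha> \<beta> s * jacobi_poly L \<alpha> \<beta> t)"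
  have "s * (s + \<alpha> + \<beta> + 1) * ?I = t * (t + \<alpha> + \<beta> + 1) * ?I"
    using jacobi_integral_pderiv[of s "jacobi_poly L \<alpha> \<beta> t"]
      jacobi_integral_pderiv[of t "jacobi_poly L \<alpha> \<beta> s"]
    by (simp only: mult.commute mult.left_commute)
  then have "(real s - real t) * (real s + real t + \<alpha> + \<beta> + 1) * ?I = 0" by (simp add: algebra_simps)
  moreover have "real s + real t + \<alpha> + \<beta> + 1 > 0"
  proof -
    have "1 \<le> s + t" using assms by linarith
    then have "1 \<le> real s + real t" by linarith
    then show ?thesis using \<alpha> \<beta> by linarith
  qed
  ultimately show ?thesis using assms by simp
qed

end

text \<open>Peels off leading coefficients. It serves twice: for orthogonality to all lower degrees,
  and to realise a given sequence of residual polynomials by update coefficients.\<close>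

lemma poly_in_span_of_graded:
  fixes P :: "nat \<Rightarrow> 'a::field poly"
  assumes "\<And>t. degree (P t) = t" and "P 0 \<noteq> 0" and "degree q < n"
  obtains a where "q = (\<Sum>s<n. smult (a s) (P s))"
  using assms(3)
proof (induction n arbitrary: q thesis)
  case (Suc n)
  have lc: "coeff (P n) n \<noteq> 0"
    using assms(1,2) by (metis leading_coeff_0_iff degree_0)
  define b where "b = coeff q n / coeff (P n) n"
  define r where "r = q - smult b (P n)"
  have "coeff r n = 0" using lc by (simp add: r_def b_def)
  moreover have "degree r \<le> n" using Suc.prems(2) assms(1)
    by (auto simp: r_def intro!: degree_diff_le degree_smult_le[THEN order_trans])
  ultimately have r: "r = 0 \<or> degree r < n"
    by (metis eq_zero_or_degree_less)
  have "\<exists>a. r = (\<Sum>s<n. smult (a s) (P s))"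
  proof (cases "r = 0")
    case True
    then show ?thesis by (intro exI[of _ "\<lambda>_. 0"]) simp
  next
    case False
    with r show ?thesis using Suc.IH by blast
  qed
  then obtain a where a: "r = (\<Sum>s<n. smult (a s) (P s))" by blast
  have "q = (\<Sum>s<Suc n. smult ((a(n := b)) s) (P s))"
    using a by (simp add: r_def algebra_simps)
  then show ?case by (rule Suc.prems(1))
qed simp

lemma jacobi_poly_orthogonal_lower_degree:
  assumes L: "0 < L" and \<alpha>: "-1 < \<alpha>" and \<beta>: "-1 < \<beta>" and "degree q < t"
  shows "jacobi_integral L \<alpha> \<beta> (jacobi_poly L \<alpha> \<beta> t * q) = 0"
proof -
  have "jacobi_poly L \<alpha> \<beta> 0 \<noteq> 0" using poly_jacobi_poly_0[of L \<alpha> \<beta> 0] by auto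
  then obtain a where "q = (\<Sum>s<t. smult (a s) (jacobi_poly L \<alpha> \<beta> s))"
    using poly_in_span_of_graded[OF degree_jacobi_poly[OF L \<alpha> \<beta>] _ assms(4)] by blast
  then show ?thesis
    by (simp add: sum_distrib_left jacobi_integral_sum[OF L \<alpha> \<beta>] jacobi_integral_smult[OF L \<alpha> \<beta>]
        jacobi_poly_orthogonal[OF L \<alpha> \<beta>])
qed

lemma shifted_jacobi_jacobi_poly:
  assumes "0 < L" "-1 < \<alpha>" "-1 < \<beta>"
  shows "shifted_jacobi L \<alpha> \<beta> (jacobi_poly L \<alpha> \<beta>)"
  using degree_jacobi_poly[OF assms] jacobi_poly_orthogonal[OF assms]
  by (simp add: shifted_jacobi_def poly_jacobi_poly_0 jacobi_integral_def)

section \<open>The minimal weighted mean square\<close>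

text \<open>Up to sign the alternating sum is the n-th finite difference of \<open>f\<close> at 0;
  Pascal's rule carries out one of the differences. This is the induction step of the next two
  sums.\<close>

lemma alternating_binomial_sum_Suc:
  fixes f :: "nat \<Rightarrow> real"
  shows "(\<Sum>k\<le>Suc n. (-1) ^ k * real (Suc n choose k) * f k)
       = (\<Sum>k\<le>n. (-1) ^ k * real (n choose k) * (f k - f (Suc k)))"
proof -
  have "(\<Sum>k\<le>Suc n. (-1) ^ k * real (Suc n choose k) * f k)
     = f 0 + (\<Sum>k\<le>n. (-1) ^ Suc k * (real (n choose k) + real (n choose Suc k)) * f (Suc k))"
    by (subst sum.atMost_Suc_shift) simp
  also have "\<dots> = f 0 + (\<Sum>k\<le>n. (-1) ^ Suc k * real (n choose Suc k) * f (Suc k))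
     - (\<Sum>k\<le>n. (-1) ^ k * real (n choose k) * f (Suc k))"
    by (simp add: algebra_simps sum.distrib sum_subtractf sum_negf)
  also have "f 0 + (\<Sum>k\<le>n. (-1) ^ Suc k * real (n choose Suc k) * f (Suc k))
     = (\<Sum>k\<le>Suc n. (-1) ^ k * real (n choose k) * f k)"
    by (subst sum.atMost_Suc_shift) simp
  also have "\<dots> = (\<Sum>k\<le>n. (-1) ^ k * real (n choose k) * f k)"
    by (simp add: binomial_eq_0)
  finally show ?thesis by (simp add: algebra_simps sum_subtractf)
qed

text \<open>Each difference cancels the leading term, because a unit shift preserves the leading
  coefficient; more differences than the degree annihilate the polynomial.\<close>

lemma alternating_binomial_sum_poly_eq_0:
  fixes r :: "real poly"
  assumes "degree r < n"
  shows "(\<Sum>k\<le>n. (-1) ^ k * real (n choose k) * poly r k) = 0"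
  using assms
proof (induction n arbitrary: r)
  case (Suc n)
  define s where "s = r - pcompose r [:1, 1:]"
  have "poly r k - poly r (Suc k) = poly s k" for k :: nat
    by (simp add: s_def poly_pcompose add.commute)
  then have eq: "(\<Sum>k\<le>Suc n. (-1) ^ k * real (Suc n choose k) * poly r k)
      = (\<Sum>k\<le>n. (-1) ^ k * real (n choose k) * poly s k)"
    by (simp only: alternating_binomial_sum_Suc)
  show ?case
  proof (cases "s = 0")
    case True
    then show ?thesis unfolding eq by simp
  next
    case False
    have "degree s \<le> degree r" by (simp add: s_def degree_diff_le degree_pcompose)
    moreover have "coeff s (degree r) = 0"
      using lead_coeff_comp[of "[:1, 1:]" r] by (simp add: s_def degree_pcompose)
    ultimately have "degree s < degree r" using False eq_zero_or_degree_less by blast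
    then show ?thesis unfolding eq using Suc by simp
  qed
qed simp

text \<open>Partial fractions of the right-hand side in \<open>b\<close>. One difference pairs the
  sums for \<open>b\<close> and \<open>b + 1\<close>, so the induction keeps \<open>b\<close>
  arbitrary.\<close>

lemma alternating_binomial_sum_inverse:
  fixes b :: real
  assumes "0 < b"
  shows "(\<Sum>k\<le>n. (-1) ^ k * real (n choose k) * (1 / (b + k))) = fact n / pochhammer b (Suc n)"
  using assms
proof (induction n arbitrary: b)
  case (Suc n)
  have pos: "pochhammer (b + 1) n > 0" using Suc.prems by (intro pochhammer_pos) auto
  have "(\<Sum>k\<le>Suc n. (-1) ^ k * real (Suc n choose k) * (1 / (b + k)))
      = fact n / pochhammer b (Suc n) - fact n / pochhammer (b + 1) (Suc n)"
    using Suc.IH[of b] Suc.IH[of "b + 1"] Suc.prems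
    unfolding alternating_binomial_sum_Suc by (simp add: algebra_simps sum_subtractf)
  also have "pochhammer b (Suc n) = b * pochhammer (b + 1) n" by (rule pochhammer_rec)
  also have "pochhammer (b + 1) (Suc n) = (b + 1 + n) * pochhammer (b + 1) n"
    by (simp add: pochhammer_rec')
  also have "fact n / (b * pochhammer (b + 1) n) - fact n / ((b + 1 + n) * pochhammer (b + 1) n)
      = fact (Suc n) / (b * ((b + 1 + n) * pochhammer (b + 1) n))"
  proof -
    define N where "N = b + 1 + n"
    have "N > 0" using Suc.prems by (simp add: N_def)
    then have "fact n / (b * pochhammer (b + 1) n) - fact n / (N * pochhammer (b + 1) n)
      = (N - b) * fact n / (b * (N * pochhammer (b + 1) n))"
      using pos Suc.prems by (simp add: field_simps)
    then show ?thesis by (simp add: N_def algebra_simps)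
  qed
  also have "b * ((b + 1 + n) * pochhammer (b + 1) n) = pochhammer b (Suc (Suc n))"
    by (simp add: pochhammer_rec[of b "Suc n"] pochhammer_rec'[of "b + 1" n] del: pochhammer_Suc)
  finally show ?case .
qed simp

text \<open>An instance of the Pfaff--Saalschuetz identity: splitting \<open>(c + k)\<^sub>n\<close>, as a polynomial in
  \<open>k\<close>, at the pole \<open>k = -b\<close> reduces it to the two preceding sums.\<close>

lemma alternating_binomial_sum_pochhammer:
  fixes b c :: real
  assumes "0 < b" "0 < c"
  shows "(\<Sum>k\<le>n. (-1) ^ k * real (n choose k) * (pochhammer (c + n) k / pochhammer c k) * (1 / (b + k)))
       = pochhammer (c - b) n * fact n / (pochhammer c n * pochhammer b (Suc n))"
proof -
  define g where "g = (\<Prod>i<n. [:c + i, 1:])"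
  have poly_g: "poly g x = pochhammer (c + x) n" for x
    by (simp add: g_def poly_prod pochhammer_prod lessThan_atLeast0 algebra_simps)
  have "degree g = n" by (simp add: g_def degree_prod_eq_sum_degree)
  have "poly (g - [:poly g (- b):]) (- b) = 0" by simp
  then have "[:b, 1:] dvd g - [:poly g (- b):]" by (simp only: poly_eq_0_iff_dvd) simp
  then obtain r where r: "g - [:poly g (- b):] = [:b, 1:] * r" by (rule dvdE)
  have r_deg: "r = 0 \<or> degree r < n"
  proof (cases "r = 0")
    case False
    have "degree ([:b, 1:] * r) = Suc (degree r)" using False by (subst degree_mult_eq) auto
    moreover have "degree (g - [:poly g (- b):]) \<le> n"
      using \<open>degree g = n\<close> by (intro degree_diff_le) auto
    ultimately show ?thesis using r by simp
  qed simp
  have split: "pochhammer (c + n) k / pochhammer c k * (1 / (b + k))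
     = (pochhammer (c - b) n * (1 / (b + k)) + poly r k) / pochhammer c n" for k
  proof -
    have pos: "pochhammer c k > 0" "pochhammer c n > 0" "b + k > 0"
      using assms by (auto intro!: pochhammer_pos)
    \<comment> \<open>Both sides are the product of length \<open>n + k\<close> starting at
      \<open>c\<close>. The exchange turns a quotient with \<open>k\<close> in the length into a
      polynomial in \<open>k\<close> over a constant.\<close>
    have "pochhammer c n * pochhammer (c + n) k = pochhammer c k * pochhammer (c + k) n"
      using pochhammer_product'[of c n k] pochhammer_product'[of c k n] by (simp add: add.commute)
    then have "pochhammer (c + n) k / pochhammer c k = pochhammer (c + k) n / pochhammer c n"
      using pos by (simp add: frac_eq_eq mult_ac)
    moreover have "pochhammer (c + k) n = pochhammer (c - b) n + (b + k) * poly r k"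
      using arg_cong[OF r, of "\<lambda>p. poly p (real k)"] by (simp add: poly_g algebra_simps)
    moreover have "(pochhammer (c - b) n + (b + k) * poly r k) / (b + k)
        = pochhammer (c - b) n * (1 / (b + k)) + poly r k"
      using pos by (simp add: add_divide_distrib)
    ultimately show ?thesis by (metis (no_types, lifting) divide_divide_eq_left mult.commute
          times_divide_eq_right mult.right_neutral)
  qed
  have "(\<Sum>k\<le>n. (-1) ^ k * real (n choose k) * (pochhammer (c + n) k / pochhammer c k) * (1 / (b + k)))
      = (\<Sum>k\<le>n. ((-1) ^ k * real (n choose k) * (1 / (b + k)) * pochhammer (c - b) n
            + (-1) ^ k * real (n choose k) * poly r k) / pochhammer c n)"
    by (intro sum.cong refl, subst mult.assoc, subst split) (simp add: algebra_simps)
  also have "\<dots> = ((\<Sum>k\<le>n. (-1) ^ k * real (n choose k) * (1 / (b + k))) * pochhammer (c - b) n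
      + (\<Sum>k\<le>n. (-1) ^ k * real (n choose k) * poly r k)) / pochhammer c n"
    by (simp only: sum_divide_distrib[symmetric] sum.distrib sum_distrib_right)
  also have "(\<Sum>k\<le>n. (-1) ^ k * real (n choose k) * poly r k) = 0"
    using r_deg alternating_binomial_sum_poly_eq_0[of r n] by auto
  finally show ?thesis
    unfolding alternating_binomial_sum_inverse[OF assms(1)] by (simp add: mult_ac)
qed

section \<open>Closed form and growth of the minimum\<close>

lemma Beta_add_nat:
  fixes a b :: real
  assumes "0 < a" "0 < b"
  shows "Beta (a + n) b = Beta a b * pochhammer a n / pochhammer (a + b) n"
proof (induction n)
  case (Suc n)
  have "pochhammer (a + b) n > 0" "a + b + n > 0" using assms by (auto intro!: pochhammer_pos)
  moreover have "a + n \<notin> \<int>\<^sub>\<le>\<^sub>0" using assms by (auto elim!: nonpos_Ints_cases)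
  from Beta_plus1_left[OF this, of b]
  have "(a + b + n) * Beta (a + Suc n) b = (a + n) * Beta (a + n) b" by (simp add: algebra_simps)
  ultimately have "Beta (a + Suc n) b = (a + n) * Beta (a + n) b / (a + b + n)"
    by (simp add: eq_divide_eq mult_ac)
  then show ?case unfolding Suc by (simp add: pochhammer_Suc mult_ac)
qed simp

text \<open>The limit formula for the Gamma function read as a growth rate. The factorial cancels
  later, where equally many Pochhammer symbols stand above and below.\<close>

lemma pochhammer_bigtheta:
  fixes a :: real
  assumes "0 < a"
  shows "(\<lambda>n. pochhammer a n) \<in> \<Theta>(\<lambda>n. fact (n - 1) * real n powr a)"
proof -
  have "(\<lambda>n. fact (n - 1) * real n powr a / pochhammer a n) \<longlonglongrightarrow> Gamma a"
  proof (rule Lim_transform_eventually[OF Gamma_series'_LIMSEQ])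
    show "eventually (\<lambda>n. Gamma_series' a n = fact (n - 1) * real n powr a / pochhammer a n) sequentially"
      using eventually_gt_at_top[of 0]
      by eventually_elim (simp add: Gamma_series'_def powr_def)
  qed
  moreover have "Gamma a \<noteq> 0" using Gamma_real_pos[OF assms] by simp
  moreover have "eventually (\<lambda>n. pochhammer a n \<noteq> 0) sequentially"
    using pochhammer_pos[OF assms] by (intro always_eventually allI) (metis less_irrefl)
  ultimately have "(\<lambda>n. fact (n - 1) * real n powr a) \<in> \<Theta>(\<lambda>n. pochhammer a n)"
    by (intro bigthetaI_tendsto[of "Gamma a"]) auto
  then show ?thesis by (simp add: bigtheta_sym)
qed

text \<open>Termwise integration. Since the weight has exponent \<open>\<beta> - 1\<close> while the
  polynomial has parameter \<open>\<beta>\<close>, the quotient of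
  \<open>pochhammer \<beta> k\<close> by \<open>pochhammer (\<beta> + 1) k\<close> collapses to
  \<open>\<beta> / (\<beta> + k)\<close>, the simple pole in
  \<open>alternating_binomial_sum_pochhammer\<close> for \<open>b = \<beta>\<close> and
  \<open>c = \<alpha> + \<beta> + 1\<close>.\<close>

lemma jacobi_integral_jacobi_poly:
  assumes L: "0 < L" and \<alpha>: "-1 < \<alpha>" and \<beta>: "0 < \<beta>"
  shows "jacobi_integral L \<alpha> (\<beta> - 1) (jacobi_poly L \<alpha> \<beta> t)
     = L powr (\<alpha> + \<beta>) * Beta \<beta> (\<alpha> + 1) *
       (pochhammer (\<alpha> + 1) t * fact t / (pochhammer (\<alpha> + \<beta> + 1) t * pochhammer (\<beta> + 1) t))"
proof -
  define c where "c = \<alpha> + \<beta> + 1"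
  have c: "0 < c" using \<alpha> \<beta> by (simp add: c_def)
  let ?K = "L powr (\<alpha> + \<beta>) * Beta \<beta> (\<alpha> + 1) * \<beta>"
  let ?a = "\<lambda>k. (-1) ^ k * real (t choose k) * pochhammer (t + \<alpha> + \<beta> + 1) k / (pochhammer (\<beta> + 1) k * L ^ k)"
  have "jacobi_integral L \<alpha> (\<beta> - 1) (monom (?a k) k)
     = ?K * ((-1) ^ k * real (t choose k) * (pochhammer (c + t) k / pochhammer c k) * (1 / (\<beta> + k)))"
    for k
  proof -
    have "pochhammer (\<beta> + 1) k > 0" using \<beta> by (intro pochhammer_pos) auto
    moreover have "\<beta> * pochhammer (\<beta> + 1) k = pochhammer \<beta> k * (\<beta> + k)"
      by (metis pochhammer_rec pochhammer_Suc)
    ultimately have ratio: "pochhammer \<beta> k / pochhammer (\<beta> + 1) k = \<beta> / (\<beta> + k)"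
      using \<beta> by (simp add: frac_eq_eq mult_ac)
    have "jacobi_integral L \<alpha> (\<beta> - 1) (monom (?a k) k)
       = ?a k * (L powr (\<alpha> + \<beta> + k) * Beta (\<beta> + k) (\<alpha> + 1))"
      using jacobi_integral_monom[OF L \<alpha>, of "\<beta> - 1" "?a k" k] \<beta> by (simp add: algebra_simps)
    also have "L powr (\<alpha> + \<beta> + k) = L powr (\<alpha> + \<beta>) * L ^ k"
      using L by (simp add: powr_add powr_realpow)
    also have "Beta (\<beta> + k) (\<alpha> + 1) = Beta \<beta> (\<alpha> + 1) * pochhammer \<beta> k / pochhammer c k"
      using \<alpha> \<beta> by (simp add: Beta_add_nat c_def add_ac)
    also have "?a k * (L powr (\<alpha> + \<beta>) * L ^ k * (Beta \<beta> (\<alpha> + 1) * pochhammer \<beta> k / pochhammer c k))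
       = L powr (\<alpha> + \<beta>) * Beta \<beta> (\<alpha> + 1) * ((-1) ^ k * real (t choose k) *
          (pochhammer (c + t) k / pochhammer c k) * (pochhammer \<beta> k / pochhammer (\<beta> + 1) k))"
      using L by (simp add: c_def add_ac mult_ac)
    finally show ?thesis unfolding ratio by simp
  qed
  moreover have "jacobi_integral L \<alpha> (\<beta> - 1) (jacobi_poly L \<alpha> \<beta> t)
      = (\<Sum>k\<le>t. jacobi_integral L \<alpha> (\<beta> - 1) (monom (?a k) k))"
    unfolding jacobi_poly_def using \<beta> by (intro jacobi_integral_sum L \<alpha>) simp
  ultimately have "jacobi_integral L \<alpha> (\<beta> - 1) (jacobi_poly L \<alpha> \<beta> t) = ?K *
      (pochhammer (c - \<beta>) t * fact t / (pochhammer c t * pochhammer \<beta> (Suc t)))"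
    unfolding alternating_binomial_sum_pochhammer[OF \<beta> c, symmetric] sum_distrib_left
    by (simp only:)
  also have "pochhammer \<beta> (Suc t) = \<beta> * pochhammer (\<beta> + 1) t" by (rule pochhammer_rec)
  finally show ?thesis using \<beta> by (simp add: c_def)
qed

text \<open>With \<open>fact t\<close> read as \<open>pochhammer 1 t\<close>, the exponents add up
  to (\<alpha> + 1) + 1 - (\<alpha> + \<beta> + 1) - (\<beta> + 1) = -2\<beta>.\<close>

lemma jacobi_integral_jacobi_poly_bigtheta:
  assumes L: "0 < L" and \<alpha>: "-1 < \<alpha>" and \<beta>: "0 < \<beta>"
  shows "(\<lambda>t. jacobi_integral L \<alpha> (\<beta> - 1) (jacobi_poly L \<alpha> \<beta> t)) \<in> \<Theta>(\<lambda>t. real t powr (- 2 * \<beta>))"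
proof -
  have "Beta \<beta> (\<alpha> + 1) > 0" using \<alpha> \<beta> by (simp add: Beta_def Gamma_real_pos)
  then have K: "L powr (\<alpha> + \<beta>) * Beta \<beta> (\<alpha> + 1) \<noteq> 0" using L by simp
  let ?p = "\<lambda>a t. pochhammer a t :: real" and ?q = "\<lambda>a t. fact (t - 1) * real t powr a"
  have "(\<lambda>t. jacobi_integral L \<alpha> (\<beta> - 1) (jacobi_poly L \<alpha> \<beta> t))
     \<in> \<Theta>(\<lambda>t. ?p (\<alpha> + 1) t * ?p 1 t / (?p (\<alpha> + \<beta> + 1) t * ?p (\<beta> + 1) t))"
    unfolding jacobi_integral_jacobi_poly[OF assms] pochhammer_fact using K
    by (intro landau_theta.cmult_in_iff[THEN iffD2]) auto
  also have "(\<lambda>t. ?p (\<alpha> + 1) t * ?p 1 t / (?p (\<alpha> + \<beta> + 1) t * ?p (\<beta> + 1) t))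
     \<in> \<Theta>(\<lambda>t. ?q (\<alpha> + 1) t * ?q 1 t / (?q (\<alpha> + \<beta> + 1) t * ?q (\<beta> + 1) t))"
    by (intro landau_theta.mult landau_theta.divide pochhammer_bigtheta
        pochhammer_bigtheta[THEN bigtheta_sym[THEN iffD1]])
      (use \<alpha> \<beta> in \<open>auto intro!: eventually_mono[OF eventually_gt_at_top[of 0]] simp: pochhammer_eq_0_iff\<close>)
  also have "(\<lambda>t. ?q (\<alpha> + 1) t * ?q 1 t / (?q (\<alpha> + \<beta> + 1) t * ?q (\<beta> + 1) t))
     \<in> \<Theta>(\<lambda>t. real t powr (- 2 * \<beta>))"
  proof (rule bigthetaI_cong, rule eventually_mono[OF eventually_gt_at_top[of 0]])
    fix t :: nat assume t: "0 < t"
    have "?q (\<alpha> + 1) t * ?q 1 t / (?q (\<alpha> + \<beta> + 1) t * ?q (\<beta> + 1) t)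
       = (real t powr (\<alpha> + 1) * real t powr 1) / (real t powr (\<alpha> + \<beta> + 1) * real t powr (\<beta> + 1))"
      by (simp add: field_simps)
    also have "\<dots> = real t powr ((\<alpha> + 1) + 1 - ((\<alpha> + \<beta> + 1) + (\<beta> + 1)))"
      by (simp only: powr_add powr_diff)
    also have "(\<alpha> + 1) + 1 - ((\<alpha> + \<beta> + 1) + (\<beta> + 1)) = - 2 * \<beta>" by simp
    finally show "?q (\<alpha> + 1) t * ?q 1 t / (?q (\<alpha> + \<beta> + 1) t * ?q (\<beta> + 1) t) = real t powr (- 2 * \<beta>)" .
  qed
  finally show ?thesis .
qed

section \<open>Minimality among residual polynomials\<close>

lemma jacobi_integral_mult_pCons:
  assumes "0 < L"
  shows "jacobi_integral L \<alpha> (\<beta> - 1) ([:0, 1:] * q) = jacobi_integral L \<alpha> \<beta> q"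
  unfolding jacobi_integral_def
  by (intro set_lebesgue_integral_cong) (auto simp: powr_diff)

text \<open>Since \<open>p(0) = 1\<close> fixes \<open>p\<close> up to multiples of \<open>x\<close>, orthogonality to lower degrees for the
  exponent \<open>\<beta>\<close> is orthogonality to \<open>p - P\<^sub>t\<close> for the exponent \<open>\<beta> - 1\<close>.\<close>

lemma jacobi_integral_residual:
  assumes L: "0 < L" and \<alpha>: "-1 < \<alpha>" and \<beta>: "0 < \<beta>"
    and p: "degree p \<le> t" "poly p 0 = 1"
  shows "jacobi_integral L \<alpha> (\<beta> - 1) (jacobi_poly L \<alpha> \<beta> t * p)
       = jacobi_integral L \<alpha> (\<beta> - 1) (jacobi_poly L \<alpha> \<beta> t)"
proof -
  have "poly (p - 1) 0 = 0" using p by simp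
  then have "[:0, 1:] dvd p - 1" using poly_eq_0_iff_dvd[of "p - 1" 0] by simp
  then obtain r where r: "p - 1 = [:0, 1:] * r" by (rule dvdE)
  have "jacobi_integral L \<alpha> \<beta> (jacobi_poly L \<alpha> \<beta> t * r) = 0"
  proof (cases "r = 0")
    case True
    then show ?thesis by (simp add: jacobi_integral_def)
  next
    case False
    \<comment> \<open>Division by x costs one degree, so that \<open>r\<close> falls strictly below
      \<open>t\<close> although \<open>p\<close> may reach it.\<close>
    then have "Suc (degree r) = degree (p - 1)" unfolding r by simp
    also have "\<dots> \<le> t" using p by (intro degree_diff_le) auto
    finally show ?thesis using jacobi_poly_orthogonal_lower_degree[OF L \<alpha>] \<beta> by simp
  qed
  moreover have "jacobi_poly L \<alpha> \<beta> t * p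
      = jacobi_poly L \<alpha> \<beta> t + [:0, 1:] * (jacobi_poly L \<alpha> \<beta> t * r)"
  proof -
    have "p = 1 + [:0, 1:] * r" using r by (simp add: algebra_simps)
    then show ?thesis by (simp add: algebra_simps)
  qed
  ultimately show ?thesis
    using jacobi_integral_add[OF L \<alpha>, of "\<beta> - 1"] jacobi_integral_mult_pCons[OF L] \<beta> by simp
qed

text \<open>Pythagoras: the cross term and the square of the Jacobi polynomial both integrate to the
  same value as the polynomial itself, so the mean square of the difference is the difference of the
  two sides.\<close>

lemma jacobi_integral_residual_ge:
  assumes L: "0 < L" and \<alpha>: "-1 < \<alpha>" and \<beta>: "0 < \<beta>"
    and p: "degree p \<le> t" "poly p 0 = 1"
  shows "jacobi_integral L \<alpha> (\<beta> - 1) (jacobi_poly L \<alpha> \<beta> t) \<le> jacobi_integral L \<alpha> (\<beta> - 1) (p\<^sup>2)"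
proof -
  let ?P = "jacobi_poly L \<alpha> \<beta> t" and ?W = "jacobi_integral L \<alpha> (\<beta> - 1)"
  have \<beta>': "-1 < \<beta> - 1" using \<beta> by simp
  have "0 \<le> ?W ((p - ?P)\<^sup>2)" by (intro jacobi_integral_nonneg[OF L \<alpha> \<beta>']) simp
  also have "(p - ?P)\<^sup>2 = p\<^sup>2 - (?P * p + ?P * p) + ?P * ?P"
    by (simp add: power2_eq_square algebra_simps)
  also have "?W \<dots> = ?W (p\<^sup>2) - (?W (?P * p) + ?W (?P * p)) + ?W (?P * ?P)"
    by (simp only: jacobi_integral_add[OF L \<alpha> \<beta>'] jacobi_integral_diff[OF L \<alpha> \<beta>'])
  also have "?W (?P * p) = ?W ?P" by (rule jacobi_integral_residual[OF L \<alpha> \<beta> p])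
  also have "?W (?P * ?P) = ?W ?P"
    using \<beta> L \<alpha> by (intro jacobi_integral_residual) (auto simp: degree_jacobi_poly poly_jacobi_poly_0)
  finally show ?thesis by simp
qed

lemma jacobi_integral_jacobi_poly_square:
  assumes L: "0 < L" and \<alpha>: "-1 < \<alpha>" and \<beta>: "0 < \<beta>"
  shows "jacobi_integral L \<alpha> (\<beta> - 1) ((jacobi_poly L \<alpha> \<beta> t)\<^sup>2)
       = jacobi_integral L \<alpha> (\<beta> - 1) (jacobi_poly L \<alpha> \<beta> t)"
  unfolding power2_eq_square
  using \<beta> L \<alpha> by (intro jacobi_integral_residual) (auto simp: degree_jacobi_poly poly_jacobi_poly_0)

section \<open>Interior bounds\<close>

text \<open>A power function is monotone, so its minimum lies at an endpoint; taking both endpoints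
  spares a distinction on the sign of \<open>s\<close> wherever this is used.\<close>

lemma powr_ge_min:
  fixes a b s x :: real
  assumes "0 < a" "a \<le> x" "x \<le> b"
  shows "min (a powr s) (b powr s) \<le> x powr s"
proof (cases "0 \<le> s")
  case True
  then have "a powr s \<le> x powr s" using assms by (intro powr_mono2) auto
  then show ?thesis by simp
next
  case False
  then have "b powr s \<le> x powr s" using assms by (intro powr_mono2') auto
  then show ?thesis by simp
qed

text \<open>Gronwall's inequality in both directions: \<open>f u * exp (C * u)\<close> does not
  decrease and \<open>f u * exp (- C * u)\<close> does not increase. Both are needed because
  \<open>y\<close> will run over the whole interval while \<open>x\<close> is fixed.\<close>

lemma exp_growth_bound:
  fixes f f' :: "real \<Rightarrow> real"
  assumes deriv: "\<And>u. u \<in> {a..b} \<Longrightarrow> (f has_real_derivative f' u) (at u)"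
    and bound: "\<And>u. u \<in> {a..b} \<Longrightarrow> \<bar>f' u\<bar> \<le> C * f u"
    and nonneg: "\<And>u. u \<in> {a..b} \<Longrightarrow> 0 \<le> f u"
    and C: "0 \<le> C" and x: "x \<in> {a..b}" and y: "y \<in> {a..b}"
  shows "f x \<le> exp (C * (b - a)) * f y"
proof (cases "x \<le> y")
  case True
  have "f x * exp (C * x) \<le> f y * exp (C * y)"
  proof (rule DERIV_nonneg_imp_nondecreasing[OF True])
    fix u assume "x \<le> u" "u \<le> y"
    then have u: "u \<in> {a..b}" using x y by auto
    have "((\<lambda>u. f u * exp (C * u)) has_real_derivative (f' u + C * f u) * exp (C * u)) (at u)"
      by (auto intro!: derivative_eq_intros deriv u simp: algebra_simps)
    moreover have "0 \<le> (f' u + C * f u) * exp (C * u)" using bound[OF u] by simp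
    ultimately show "\<exists>d. ((\<lambda>u. f u * exp (C * u)) has_real_derivative d) (at u) \<and> 0 \<le> d" by blast
  qed
  then have "f x \<le> exp (C * (y - x)) * f y"
    by (simp add: exp_diff right_diff_distrib field_simps)
  also have "\<dots> \<le> exp (C * (b - a)) * f y"
    using x y C nonneg[OF y] by (intro mult_right_mono) (auto intro!: mult_left_mono)
  finally show ?thesis .
next
  case False
  have "f y * exp (- C * y) \<ge> f x * exp (- C * x)"
  proof (rule DERIV_nonpos_imp_nonincreasing[where f = "\<lambda>u. f u * exp (- C * u)"])
    show "y \<le> x" using False by simp
    fix u assume "y \<le> u" "u \<le> x"
    then have u: "u \<in> {a..b}" using x y by auto
    have "((\<lambda>u. f u * exp (- C * u)) has_real_derivative (f' u - C * f u) * exp (- C * u)) (at u)"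
      by (auto intro!: derivative_eq_intros deriv u simp: algebra_simps)
    moreover have "(f' u - C * f u) * exp (- C * u) \<le> 0"
      using bound[OF u] by (auto intro: mult_nonpos_nonneg)
    ultimately show "\<exists>d. ((\<lambda>u. f u * exp (- C * u)) has_real_derivative d) (at u) \<and> d \<le> 0" by blast
  qed
  then have "f x \<le> exp (C * (x - y)) * f y"
    by (simp add: exp_diff exp_minus right_diff_distrib field_simps)
  also have "\<dots> \<le> exp (C * (b - a)) * f y"
    using x y C nonneg[OF y] by (intro mult_right_mono) (auto intro!: mult_left_mono)
  finally show ?thesis .
qed

text \<open>Sonin's function \<open>y\<^sup>2 + x (L - x) y'\<^sup>2 / \<lambda>\<close>, with \<open>\<lambda>\<close> the eigenvalue of the Jacobi equation, has
  a logarithmic derivative that is bounded on compact subintervals uniformly in the degree; its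
  weighted integral is twice that of \<open>y\<^sup>2\<close>. Hence \<open>y\<^sup>2\<close> is bounded by its mean.\<close>

lemma jacobi_poly_interior_bound:
  assumes L: "0 < L" and \<alpha>: "-1 < \<alpha>" and \<beta>: "-1 < \<beta>" and \<epsilon>: "0 < \<epsilon>" "\<epsilon> < L / 2"
  obtains C where "0 < C"
    and "\<And>t x. 1 \<le> t \<Longrightarrow> x \<in> {\<epsilon>..L - \<epsilon>} \<Longrightarrow>
      (poly (jacobi_poly L \<alpha> \<beta> t) x)\<^sup>2 \<le> C * jacobi_integral L \<alpha> \<beta> ((jacobi_poly L \<alpha> \<beta> t)\<^sup>2)"
proof -
  \<comment> \<open>\<open>K\<close> bounds the logarithmic derivative: its numerator bounds
    \<open>r\<close> below, and \<open>\<epsilon>\<^sup>2\<close> is a lower bound of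
    \<open>u * (L - u)\<close>. \<open>E\<close> is the resulting Gronwall factor, \<open>m\<close>
    a lower bound of the weight in the interior.\<close>
  define K where "K = (L + 2 * ((\<bar>\<beta> + 1\<bar> + \<bar>\<alpha> + \<beta> + 2\<bar>) * L)) / \<epsilon>\<^sup>2"
  define E where "E = exp (K * (L - \<epsilon> - \<epsilon>))"
  define m where "m = min (\<epsilon> powr \<beta>) (L powr \<beta>) * min (\<epsilon> powr \<alpha>) (L powr \<alpha>)"
  have K: "0 \<le> K" using L by (simp add: K_def)
  have m: "0 < m" using L \<epsilon> by (simp add: m_def)
  have w_ge: "m \<le> u powr \<beta> * (L - u) powr \<alpha>" if "u \<in> {\<epsilon>..L - \<epsilon>}" for u
    unfolding m_def using that \<epsilon> L by (intro mult_mono powr_ge_min) auto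
  have main: "(poly (jacobi_poly L \<alpha> \<beta> t) x)\<^sup>2
      \<le> 2 * E / (m * (L - \<epsilon> - \<epsilon>)) * jacobi_integral L \<alpha> \<beta> ((jacobi_poly L \<alpha> \<beta> t)\<^sup>2)"
    if t: "1 \<le> t" and x: "x \<in> {\<epsilon>..L - \<epsilon>}" for t x
  proof -
    define y where "y = jacobi_poly L \<alpha> \<beta> t"
    define lam where "lam = t * (t + \<alpha> + \<beta> + 1)"
    define F where "F = y * y + smult (1 / lam) ([:0, L, -1:] * pderiv y * pderiv y)"
    define r where "r = (\<lambda>u. (L - 2 * u) - 2 * ((\<beta> + 1) * L - (\<alpha> + \<beta> + 2) * u))"
    have lam: "lam > 0" using t \<alpha> \<beta> by (auto simp: lam_def intro!: mult_pos_pos)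
    have poly_F: "poly F u = (poly y u)\<^sup>2 + u * (L - u) * (poly (pderiv y) u)\<^sup>2 / lam" for u
      by (simp add: F_def power2_eq_square algebra_simps diff_divide_distrib)
    have F_ge: "(poly y u)\<^sup>2 \<le> poly F u" if "u \<in> {0..L}" for u
      unfolding poly_F using that lam by simp
    have F_nonneg: "0 \<le> poly F u" if "u \<in> {0..L}" for u
      using F_ge[OF that] zero_le_power2[of "poly y u"] by linarith
    \<comment> \<open>The factor \<open>1 / lam\<close> in \<open>F\<close> is chosen so that, once
      the Jacobi equation eliminates the second derivative, the mixed terms cancel and only the
      square of the first derivative remains. That square is in turn controlled by
      \<open>F\<close>.\<close>
    have poly_F': "poly (pderiv F) u = (poly (pderiv y) u)\<^sup>2 / lam * r u" for u
    proof -
      let ?y = "poly y u" and ?y' = "poly (pderiv y) u" and ?y'' = "poly (pderiv (pderiv y)) u"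
      have ode: "u * (L - u) * ?y'' = - ((\<beta> + 1) * L - (\<alpha> + \<beta> + 2) * u) * ?y' - lam * ?y"
        using arg_cong[OF jacobi_poly_ode[OF L \<alpha> \<beta>, of t, folded y_def], of "\<lambda>p. poly p u"]
        by (simp add: lam_def algebra_simps)
      have "poly (pderiv F) u
          = 2 * ?y * ?y' + ((L - 2 * u) * ?y'\<^sup>2 + 2 * ?y' * (u * (L - u) * ?y'')) / lam"
        by (simp add: F_def pderiv_add pderiv_mult pderiv_smult pderiv_pCons pderiv_minus power2_eq_square
            algebra_simps add_divide_distrib diff_divide_distrib)
      also have "\<dots> = ?y'\<^sup>2 / lam * r u"
        unfolding ode r_def using lam by (simp add: field_simps power2_eq_square)
      finally show ?thesis .
    qed
    have F'_le: "\<bar>poly (pderiv F) u\<bar> \<le> K * poly F u" if u: "u \<in> {\<epsilon>..L - \<epsilon>}" for u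
    proof -
      let ?d = "(poly (pderiv y) u)\<^sup>2 / lam"
      have d: "0 \<le> ?d" using lam by simp
      have u': "0 \<le> u" "u \<le> L" using u \<epsilon> by auto
      have "\<bar>(\<beta> + 1) * L - (\<alpha> + \<beta> + 2) * u\<bar> \<le> \<bar>\<beta> + 1\<bar> * L + \<bar>\<alpha> + \<beta> + 2\<bar> * L"
        using u' L abs_triangle_ineq4[of "(\<beta> + 1) * L" "(\<alpha> + \<beta> + 2) * u"]
          mult_left_mono[OF u'(2), of "\<bar>\<alpha> + \<beta> + 2\<bar>"]
        by (simp add: abs_mult)
      moreover have "\<bar>L - 2 * u\<bar> \<le> L" using u' by auto
      ultimately have "\<bar>r u\<bar> \<le> L + 2 * ((\<bar>\<beta> + 1\<bar> + \<bar>\<alpha> + \<beta> + 2\<bar>) * L)"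
        unfolding r_def distrib_right[of "\<bar>\<beta> + 1\<bar>"]
        by (intro order_trans[OF abs_triangle_ineq4]) (simp add: abs_mult)
      also have "\<dots> = K * \<epsilon>\<^sup>2" using \<epsilon> by (simp add: K_def)
      finally have "\<bar>r u\<bar> \<le> K * \<epsilon>\<^sup>2" .
      then have "\<bar>poly (pderiv F) u\<bar> \<le> ?d * (K * \<epsilon>\<^sup>2)"
        unfolding poly_F' abs_mult using d by (intro mult_mono) auto
      also have "\<dots> \<le> ?d * (K * (u * (L - u)))"
        using u \<epsilon> d K by (intro mult_left_mono) (auto simp: power2_eq_square intro!: mult_mono)
      also have "\<dots> \<le> K * poly F u"
        unfolding poly_F using K by (simp add: algebra_simps diff_divide_distrib)
      finally show ?thesis .
    qed
    have growth: "poly F x \<le> E * poly F u" if "u \<in> {\<epsilon>..L - \<epsilon>}" for u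
      unfolding E_def
      by (rule exp_growth_bound[where f' = "poly (pderiv F)"])
        (use F'_le F_nonneg K x that \<epsilon> in \<open>auto intro: poly_DERIV\<close>)
    \<comment> \<open>Averages \<open>poly F x \<le> E * poly F u\<close> over the interior in
      \<open>u\<close>; enlarging the domain on the right is harmless because \<open>F\<close> is
      nonnegative on all of \<open>[0, L]\<close>.\<close>
    have "(LINT u:{\<epsilon>..L - \<epsilon>}|lborel. poly F x * m)
        \<le> (LINT u:{0..L}|lborel. E * (poly F u * (u powr \<beta> * (L - u) powr \<alpha>)))"
      unfolding set_lebesgue_integral_def
    proof (rule integral_mono)
      show "integrable lborel (\<lambda>u. indicator {\<epsilon>..L - \<epsilon>} u *\<^sub>R (poly F x * m))"
        using \<epsilon> by (intro integrable_scaleR_left) auto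
      show "integrable lborel (\<lambda>u. indicator {0..L} u *\<^sub>R (E * (poly F u * (u powr \<beta> * (L - u) powr \<alpha>))))"
        using set_integrable_mult_right[OF set_integrable_jacobi[OF L \<alpha> \<beta>], of E F]
        unfolding set_integrable_def by blast
      fix u
      have "poly F x * m \<le> E * (poly F u * (u powr \<beta> * (L - u) powr \<alpha>))" if u: "u \<in> {\<epsilon>..L - \<epsilon>}"
      proof -
        have "poly F x * m \<le> (E * poly F u) * (u powr \<beta> * (L - u) powr \<alpha>)"
          using u F_nonneg[of u] growth[OF u] w_ge[OF u] m \<epsilon>
          by (intro mult_mono) (auto simp: E_def)
        then show ?thesis by (simp add: mult.assoc)
      qed
      moreover have "0 \<le> E * (poly F u * (u powr \<beta> * (L - u) powr \<alpha>))" if u: "u \<in> {0..L}"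
        using F_nonneg[OF u] by (simp add: E_def)
      ultimately show "indicator {\<epsilon>..L - \<epsilon>} u *\<^sub>R (poly F x * m)
          \<le> indicator {0..L} u *\<^sub>R (E * (poly F u * (u powr \<beta> * (L - u) powr \<alpha>)))"
        using \<epsilon> by (auto simp: indicator_def)
    qed
    moreover have "(LINT u:{0..L}|lborel. E * (poly F u * (u powr \<beta> * (L - u) powr \<alpha>)))
        = E * jacobi_integral L \<alpha> \<beta> F"
      by (simp add: jacobi_integral_def)
    moreover have "(LINT u:{\<epsilon>..L - \<epsilon>}|lborel. poly F x * m) = poly F x * m * (L - \<epsilon> - \<epsilon>)"
      using \<epsilon> by (simp add: set_lebesgue_integral_def)
    \<comment> \<open>The weak form with \<open>z = y\<close> shows that the derivative term
      contributes as much as the square of \<open>y\<close>.\<close>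
    moreover have "jacobi_integral L \<alpha> \<beta> F = 2 * jacobi_integral L \<alpha> \<beta> (y\<^sup>2)"
      using jacobi_integral_pderiv[OF L \<alpha> \<beta>, of t y, folded y_def lam_def] lam
      unfolding F_def jacobi_integral_add[OF L \<alpha> \<beta>] jacobi_integral_smult[OF L \<alpha> \<beta>]
      by (simp add: power2_eq_square field_simps)
    ultimately have "poly F x * (m * (L - \<epsilon> - \<epsilon>)) \<le> 2 * E * jacobi_integral L \<alpha> \<beta> (y\<^sup>2)"
      by (metis mult.assoc mult.left_commute mult.commute)
    then have "poly F x \<le> 2 * E / (m * (L - \<epsilon> - \<epsilon>)) * jacobi_integral L \<alpha> \<beta> (y\<^sup>2)"
      using m \<epsilon> by (simp add: pos_le_divide_eq)
    with F_ge[of x] x \<epsilon> show ?thesis unfolding y_def by auto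
  qed
  show ?thesis
  proof (rule that)
    show "0 < 2 * E / (m * (L - \<epsilon> - \<epsilon>))" using m \<epsilon> by (simp add: E_def)
  qed (rule main)
qed

text \<open>On the range of integration \<open>x \<le> L\<close>. It passes from the exponent in the
  interior bound to the one whose mean square has a closed form.\<close>

lemma jacobi_integral_square_le:
  assumes L: "0 < L" and \<alpha>: "-1 < \<alpha>" and \<beta>: "0 < \<beta>"
  shows "jacobi_integral L \<alpha> \<beta> (p\<^sup>2) \<le> L * jacobi_integral L \<alpha> (\<beta> - 1) (p\<^sup>2)"
proof -
  have \<beta>': "-1 < \<beta> - 1" using \<beta> by simp
  have "0 \<le> jacobi_integral L \<alpha> (\<beta> - 1) ([:L, -1:] * p\<^sup>2)"
    by (intro jacobi_integral_nonneg[OF L \<alpha> \<beta>']) (simp add: mult_right_mono)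
  also have "[:L, -1:] * p\<^sup>2 = smult L (p\<^sup>2) - [:0, 1:] * p\<^sup>2" by simp
  finally show ?thesis
    by (simp only: jacobi_integral_diff[OF L \<alpha> \<beta>'] jacobi_integral_smult[OF L \<alpha> \<beta>']
        jacobi_integral_mult_pCons[OF L])
qed

section \<open>Measures with prescribed edge behaviour\<close>

lemma edge_distribution_integrable_poly:
  assumes "edge_distribution L \<tau> \<xi> \<nu>"
  shows "integrable \<nu> (poly q)"
proof -
  interpret prob_space \<nu> using assms by (simp add: edge_distribution_def)
  have sets: "sets \<nu> = sets borel" using assms by (auto simp: edge_distribution_def)
  have "bounded (poly q ` {0..L})"
    by (intro compact_imp_bounded compact_continuous_image continuous_intros) auto
  then obtain B where B: "\<And>x. x \<in> {0..L} \<Longrightarrow> norm (poly q x) \<le> B"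
    by (force simp: bounded_iff)
  have ae: "AE x in \<nu>. x \<in> {0<..L}" using assms by (simp add: edge_distribution_def)
  show ?thesis
  proof (rule integrable_const_bound[of _ B])
    show "AE x in \<nu>. norm (poly q x) \<le> B" using ae by eventually_elim (rule B, simp)
    have "poly q \<in> borel_measurable borel"
      by (intro borel_measurable_continuous_onI continuous_intros)
    then show "poly q \<in> borel_measurable \<nu>" using sets by (simp cong: measurable_cong_sets)
  qed
qed

text \<open>Replaces the Landau conditions by inequalities with one \<open>\<epsilon>\<close> for
  both edges. Integrals of polynomials are moved to Lebesgue measure so that they can be compared
  with the Jacobi weight.\<close>

lemma edge_distributionE:
  assumes "edge_distribution L \<tau> \<xi> \<nu>" and L: "0 < L"
  obtains \<nu>' :: "real \<Rightarrow> real" and \<epsilon> c C :: real where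
    "\<And>q. has_bochner_integral lborel (\<lambda>x. \<nu>' x * poly q x) (\<integral>x. poly q x \<partial>\<nu>)"
    "\<And>x. 0 \<le> \<nu>' x" "AE x in lborel. \<nu>' x \<noteq> 0 \<longrightarrow> 0 < x \<and> x < L"
    "0 < \<epsilon>" "\<epsilon> < L / 2" "0 < c" "0 < C"
    "\<And>x. 0 < x \<Longrightarrow> x < \<epsilon> \<Longrightarrow> c * x powr \<xi> \<le> \<nu>' x"
    "\<And>x. 0 < x \<Longrightarrow> x < \<epsilon> \<Longrightarrow> \<nu>' x \<le> C * x powr \<xi>"
    "\<And>x. L - \<epsilon> < x \<Longrightarrow> x < L \<Longrightarrow> \<nu>' x \<le> C * (L - x) powr \<tau>"
proof -
  from assms obtain \<nu>' where \<nu>': "\<nu>' \<in> borel_measurable borel" "\<And>x. 0 \<le> \<nu>' x"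
      "\<nu> = density lborel (\<lambda>x. ennreal (\<nu>' x))"
      "\<nu>' \<in> \<Theta>[at_right 0](\<lambda>x. x powr \<xi>)" "\<nu>' \<in> \<Theta>[at_left L](\<lambda>x. (L - x) powr \<tau>)"
    and ae: "AE x in \<nu>. x \<in> {0<..L}"
    by (auto simp: edge_distribution_def)
  have meas: "poly q \<in> borel_measurable borel" for q :: "real poly"
    by (intro borel_measurable_continuous_onI continuous_intros)
  have int: "has_bochner_integral lborel (\<lambda>x. \<nu>' x * poly q x) (\<integral>x. poly q x \<partial>\<nu>)" for q
    using edge_distribution_integrable_poly[OF assms(1), of q] \<nu>'(1,2) meas[of q] unfolding \<nu>'(3)
    by (simp add: has_bochner_integral_iff integrable_density integral_density)
  have "AE x in lborel. \<nu>' x \<noteq> 0 \<longrightarrow> x \<in> {0<..L}"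
    using ae \<nu>'(1,2) unfolding \<nu>'(3)
    by (subst (asm) AE_density) (auto simp: less_le elim: eventually_mono)
  \<comment> \<open>The support may include the right endpoint, which is a null set and is dropped
    here.\<close>
  with AE_lborel_singleton[of L]
  have ae': "AE x in lborel. \<nu>' x \<noteq> 0 \<longrightarrow> 0 < x \<and> x < L" by eventually_elim auto
  obtain c b0 where c: "0 < c" "0 < b0" "\<And>x. 0 < x \<Longrightarrow> x < b0 \<Longrightarrow> c * x powr \<xi> \<le> \<nu>' x"
  proof -
    from bigthetaD2[OF \<nu>'(4)] obtain c where
      "0 < c" "eventually (\<lambda>x. norm (\<nu>' x) \<ge> c * norm (x powr \<xi>)) (at_right 0)"
      by (rule landau_omega.bigE)
    then show ?thesis using \<nu>'(2) that[of c]
      by (auto simp: eventually_at_right_field)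
  qed
  obtain C1 b1 where C1: "0 < C1" "0 < b1" "\<And>x. 0 < x \<Longrightarrow> x < b1 \<Longrightarrow> \<nu>' x \<le> C1 * x powr \<xi>"
  proof -
    from bigthetaD1[OF \<nu>'(4)] obtain c where
      "0 < c" "eventually (\<lambda>x. norm (\<nu>' x) \<le> c * norm (x powr \<xi>)) (at_right 0)"
      by (rule landau_o.bigE)
    then show ?thesis using \<nu>'(2) that[of c]
      by (auto simp: eventually_at_right_field)
  qed
  obtain C2 b2 where C2: "0 < C2" "b2 < L" "\<And>x. b2 < x \<Longrightarrow> x < L \<Longrightarrow> \<nu>' x \<le> C2 * (L - x) powr \<tau>"
  proof -
    from bigthetaD1[OF \<nu>'(5)] obtain c where
      "0 < c" "eventually (\<lambda>x. norm (\<nu>' x) \<le> c * norm ((L - x) powr \<tau>)) (at_left L)"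
      by (rule landau_o.bigE)
    then show ?thesis using \<nu>'(2) that[of c]
      by (auto simp: eventually_at_left_field)
  qed
  \<comment> \<open>\<open>L - b2\<close> is the width of the neighbourhood at the right edge;
    \<open>L / 3\<close> keeps the two neighbourhoods disjoint.\<close>
  define \<epsilon> where "\<epsilon> = min (min b0 b1) (min (L - b2) (L / 3))"
  have \<epsilon>: "0 < \<epsilon>" "\<epsilon> < L / 2" "\<epsilon> \<le> b0" "\<epsilon> \<le> b1" "b2 \<le> L - \<epsilon>"
    using c C1 C2 L by (auto simp: \<epsilon>_def min_def)
  show ?thesis
  proof (rule that[of \<nu>' \<epsilon> c "max C1 C2"])
    fix x :: real
    show "\<nu>' x \<le> max C1 C2 * x powr \<xi>" if "0 < x" "x < \<epsilon>"
      using that \<epsilon> by (intro order_trans[OF C1(3) mult_right_mono]) auto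
    show "\<nu>' x \<le> max C1 C2 * (L - x) powr \<tau>" if "L - \<epsilon> < x" "x < L"
      using that \<epsilon> by (intro order_trans[OF C2(3) mult_right_mono]) auto
  qed (use int \<nu>'(2) ae' \<epsilon> c C1 in auto)
qed

text \<open>The quantifier over \<open>p\<close> stands inside \<open>eventually\<close>: constant
  and threshold are uniform over residual polynomials, as the infimum over methods requires.\<close>

lemma edge_distribution_residual_lower_bound:
  assumes edge: "edge_distribution L \<tau> \<xi> \<nu>" and L: "0 < L" and \<xi>: "-1 < \<xi>" and k: "1 \<le> k"
  obtains C where "0 < C"
    and "eventually (\<lambda>t. \<forall>p. degree p \<le> t \<longrightarrow> poly p 0 = 1 \<longrightarrow>
           C * real t powr (- 2 * (\<xi> + k + 1)) \<le> (\<integral>x. x ^ k * (poly p x)\<^sup>2 \<partial>\<nu>)) sequentially"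
proof -
  define \<beta> where "\<beta> = \<xi> + k + 1"
  have \<beta>: "0 < \<beta>" using \<xi> k by (simp add: \<beta>_def)
  obtain \<nu>' \<epsilon> c C where \<nu>':
    "\<And>q. has_bochner_integral lborel (\<lambda>x. \<nu>' x * poly q x) (\<integral>x. poly q x \<partial>\<nu>)"
    "\<And>x. 0 \<le> \<nu>' x" "AE x in lborel. \<nu>' x \<noteq> 0 \<longrightarrow> 0 < x \<and> x < L"
    "0 < \<epsilon>" "\<epsilon> < L / 2" "0 < c" "0 < C"
    "\<And>x. 0 < x \<Longrightarrow> x < \<epsilon> \<Longrightarrow> c * x powr \<xi> \<le> \<nu>' x"
    "\<And>x. 0 < x \<Longrightarrow> x < \<epsilon> \<Longrightarrow> \<nu>' x \<le> C * x powr \<xi>"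
    "\<And>x. L - \<epsilon> < x \<Longrightarrow> x < L \<Longrightarrow> \<nu>' x \<le> C * (L - x) powr \<tau>"
    by (rule edge_distributionE[OF edge L], rule that)
  let ?I = "\<lambda>t. jacobi_integral \<epsilon> 0 (\<beta> - 1) (jacobi_poly \<epsilon> 0 \<beta> t)"
  have bound: "c * ?I t \<le> (\<integral>x. x ^ k * (poly p x)\<^sup>2 \<partial>\<nu>)" if p: "degree p \<le> t" "poly p 0 = 1" for p t
  proof -
    define q where "q = monom 1 k * p\<^sup>2"
    have q: "poly q x = x ^ k * (poly p x)\<^sup>2" for x by (simp add: q_def poly_monom)
    have "c * ?I t \<le> c * jacobi_integral \<epsilon> 0 (\<beta> - 1) (p\<^sup>2)"
      using \<nu>'(4,6) \<beta> p by (intro mult_left_mono jacobi_integral_residual_ge) auto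
    also have "\<dots> = (LINT x|lborel. indicator {0..\<epsilon>} x *\<^sub>R
        (c * (poly (p\<^sup>2) x * (x powr (\<beta> - 1) * (\<epsilon> - x) powr 0))))"
      unfolding jacobi_integral_def set_lebesgue_integral_def integral_mult_right_zero[symmetric]
      by (simp only: real_scaleR_def mult.left_commute)
    also have "\<dots> \<le> (LINT x|lborel. \<nu>' x * poly q x)"
    proof (rule integral_mono_AE)
      show "integrable lborel (\<lambda>x. indicator {0..\<epsilon>} x *\<^sub>R
          (c * (poly (p\<^sup>2) x * (x powr (\<beta> - 1) * (\<epsilon> - x) powr 0))))"
        using set_integrable_mult_right[OF set_integrable_jacobi[of \<epsilon> 0 "\<beta> - 1"], of c "p\<^sup>2"] \<nu>'(4) \<beta>
        unfolding set_integrable_def by simp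
      show "integrable lborel (\<lambda>x. \<nu>' x * poly q x)"
        using \<nu>'(1)[of q] by (simp add: has_bochner_integral_iff)
      show "AE x in lborel. indicator {0..\<epsilon>} x *\<^sub>R
          (c * (poly (p\<^sup>2) x * (x powr (\<beta> - 1) * (\<epsilon> - x) powr 0))) \<le> \<nu>' x * poly q x"
        using \<nu>'(3)
      proof eventually_elim
        case (elim x)
        have nonneg: "0 \<le> \<nu>' x * poly q x"
          using elim \<nu>'(2)[of x] by (cases "\<nu>' x = 0") (auto simp: q)
        show ?case
        proof (cases "0 < x \<and> x < \<epsilon>")
          case True
          have "c * (poly (p\<^sup>2) x * (x powr (\<beta> - 1) * (\<epsilon> - x) powr 0))
              = (c * x powr \<xi>) * (x ^ k * (poly p x)\<^sup>2)"
            using True by (simp add: \<beta>_def powr_add powr_realpow mult_ac)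
          also have "\<dots> \<le> \<nu>' x * (x ^ k * (poly p x)\<^sup>2)"
            using True \<nu>'(8)[of x] by (intro mult_right_mono) auto
          finally show ?thesis using True by (simp add: q)
        next
          case False
          \<comment> \<open>At both endpoints the left-hand integrand is 0 by the convention
            \<open>0 powr s = 0\<close>, also for \<open>s = 0\<close>, so the density bound on the
            open interval suffices.\<close>
          then have "x \<notin> {0..\<epsilon>} \<or> x = 0 \<or> x = \<epsilon>" by auto
          then show ?thesis using nonneg by auto
        qed
      qed
    qed
    also have "\<dots> = (\<integral>x. poly q x \<partial>\<nu>)" using \<nu>'(1)[of q] by (simp add: has_bochner_integral_iff)
    finally show ?thesis by (simp add: q)
  qed
  have "?I \<in> \<Omega>(\<lambda>t. real t powr (- 2 * \<beta>))"
    using \<nu>'(4) \<beta> by (intro bigthetaD2 jacobi_integral_jacobi_poly_bigtheta) auto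
  then obtain a where a: "0 < a" "eventually (\<lambda>t. norm (?I t) \<ge> a * norm (real t powr (- 2 * \<beta>))) sequentially"
    by (rule landau_omega.bigE)
  have I_nonneg: "0 \<le> ?I t" for t
    unfolding jacobi_integral_jacobi_poly_square[symmetric, OF \<nu>'(4) _ \<beta>, of 0, simplified]
    using \<nu>'(4) \<beta> by (intro jacobi_integral_nonneg) auto
  show ?thesis
  proof (rule that[of "c * a"])
    show "0 < c * a" using \<nu>'(6) a by simp
    show "eventually (\<lambda>t. \<forall>p. degree p \<le> t \<longrightarrow> poly p 0 = 1 \<longrightarrow>
           c * a * real t powr (- 2 * (\<xi> + k + 1)) \<le> (\<integral>x. x ^ k * (poly p x)\<^sup>2 \<partial>\<nu>)) sequentially"
      using a(2)
    proof eventually_elim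
      case (elim t)
      then have "a * real t powr (- 2 * (\<xi> + k + 1)) \<le> ?I t" using I_nonneg[of t] by (simp add: \<beta>_def)
      then have "c * (a * real t powr (- 2 * (\<xi> + k + 1))) \<le> c * ?I t"
        using \<nu>'(6) by (intro mult_left_mono) auto
      then show ?case using bound by (fastforce simp: mult.assoc)
    qed
  qed
qed

text \<open>At each edge only one factor of the weight matches the density; the other is bounded
  away from 0 there and is absorbed into the constant.\<close>

lemma edge_distribution_jacobi_upper_bound:
  assumes edge: "edge_distribution L \<tau> \<xi> \<nu>" and L: "0 < L" and \<tau>: "-1 < \<tau>" and \<xi>: "-1 < \<xi>" and k: "1 \<le> k"
  shows "(\<lambda>t. \<integral>x. x ^ k * (poly (jacobi_poly L \<tau> (\<xi> + k + 1) t) x)\<^sup>2 \<partial>\<nu>)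
           \<in> O(\<lambda>t. real t powr (- 2 * (\<xi> + k + 1)))"
proof -
  define \<beta> where "\<beta> = \<xi> + k + 1"
  have \<beta>: "0 < \<beta>" "-1 < \<beta>" "-1 < \<beta> - 1" using \<xi> k by (simp_all add: \<beta>_def)
  let ?P = "jacobi_poly L \<tau> \<beta>" and ?I = "\<lambda>t. jacobi_integral L \<tau> (\<beta> - 1) (jacobi_poly L \<tau> \<beta> t)"
  obtain \<nu>' \<epsilon> c C where \<nu>':
    "\<And>q. has_bochner_integral lborel (\<lambda>x. \<nu>' x * poly q x) (\<integral>x. poly q x \<partial>\<nu>)"
    "\<And>x. 0 \<le> \<nu>' x" "AE x in lborel. \<nu>' x \<noteq> 0 \<longrightarrow> 0 < x \<and> x < L"
    "0 < \<epsilon>" "\<epsilon> < L / 2" "0 < c" "0 < C"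
    "\<And>x. 0 < x \<Longrightarrow> x < \<epsilon> \<Longrightarrow> c * x powr \<xi> \<le> \<nu>' x"
    "\<And>x. 0 < x \<Longrightarrow> x < \<epsilon> \<Longrightarrow> \<nu>' x \<le> C * x powr \<xi>"
    "\<And>x. L - \<epsilon> < x \<Longrightarrow> x < L \<Longrightarrow> \<nu>' x \<le> C * (L - x) powr \<tau>"
    by (rule edge_distributionE[OF edge L], rule that)
  interpret prob_space \<nu> using edge by (simp add: edge_distribution_def)
  obtain C0 where C0: "0 < C0" "\<And>t x. 1 \<le> t \<Longrightarrow> x \<in> {\<epsilon>..L - \<epsilon>} \<Longrightarrow>
      (poly (?P t) x)\<^sup>2 \<le> C0 * jacobi_integral L \<tau> \<beta> ((?P t)\<^sup>2)"
    using jacobi_poly_interior_bound[OF L \<tau> \<beta>(2) \<nu>'(4,5)] by blast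
  \<comment> \<open>\<open>m1\<close> bounds the factor \<open>(L - x) powr \<tau>\<close> from
    below on the left half, \<open>m2\<close> the factor \<open>x powr (\<beta> - 1)\<close> on the
    right half. \<open>D\<close> adds the constants of the two edges.\<close>
  define m1 where "m1 = min ((L / 2) powr \<tau>) (L powr \<tau>)"
  define m2 where "m2 = min ((L / 2) powr (\<beta> - 1)) (L powr (\<beta> - 1))"
  define D where "D = C / m1 + C * L ^ k / m2"
  have m: "0 < m1" "0 < m2" using L by (simp_all add: m1_def m2_def)
  have D: "0 \<le> D" using m \<nu>'(7) L by (simp add: D_def)
  have sq: "jacobi_integral L \<tau> (\<beta> - 1) ((?P t)\<^sup>2) = ?I t" for t
    by (rule jacobi_integral_jacobi_poly_square[OF L \<tau> \<beta>(1)])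
  have I_nonneg: "0 \<le> ?I t" for t
    unfolding sq[symmetric] by (intro jacobi_integral_nonneg[OF L \<tau> \<beta>(3)]) simp
  have bound: "(\<integral>x. x ^ k * (poly (?P t) x)\<^sup>2 \<partial>\<nu>) \<le> (D + L ^ k * C0 * L) * ?I t" if t: "1 \<le> t" for t
  proof -
    define q where "q = monom 1 k * (?P t)\<^sup>2"
    have q: "poly q x = x ^ k * (poly (?P t) x)\<^sup>2" for x by (simp add: q_def poly_monom)
    define h where "h = C0 * (L * ?I t)"
    have h: "(poly (?P t) x)\<^sup>2 \<le> h" if "x \<in> {\<epsilon>..L - \<epsilon>}" for x
      using C0(2)[OF t that] mult_left_mono[OF jacobi_integral_square_le[OF L \<tau> \<beta>(1), of "?P t"], of C0] C0(1)
      unfolding sq h_def by linarith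
    let ?w = "\<lambda>x. poly ((?P t)\<^sup>2) x * (x powr (\<beta> - 1) * (L - x) powr \<tau>)"
    have int_w: "integrable lborel (\<lambda>x. indicator {0..L} x *\<^sub>R ?w x)"
      using set_integrable_jacobi[OF L \<tau> \<beta>(3), of "(?P t)\<^sup>2"] by (simp add: set_integrable_def)
    \<comment> \<open>The total mass is all that is used of the density in the interior.\<close>
    have one: "has_bochner_integral lborel \<nu>' 1" using \<nu>'(1)[of 1] prob_space by simp
    have "(\<integral>x. poly q x \<partial>\<nu>) = (LINT x|lborel. \<nu>' x * poly q x)"
      using \<nu>'(1)[of q] by (simp add: has_bochner_integral_iff)
    also have "\<dots> \<le> (LINT x|lborel. D * (indicator {0..L} x *\<^sub>R ?w x) + L ^ k * h * \<nu>' x)"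
    proof (rule integral_mono_AE)
      show "integrable lborel (\<lambda>x. \<nu>' x * poly q x)"
        using \<nu>'(1)[of q] by (simp add: has_bochner_integral_iff)
      show "integrable lborel (\<lambda>x. D * (indicator {0..L} x *\<^sub>R ?w x) + L ^ k * h * \<nu>' x)"
        using one by (intro Bochner_Integration.integrable_add integrable_mult_right int_w)
          (simp add: has_bochner_integral_iff)
      show "AE x in lborel. \<nu>' x * poly q x \<le> D * (indicator {0..L} x *\<^sub>R ?w x) + L ^ k * h * \<nu>' x"
        using \<nu>'(3)
      proof eventually_elim
        case (elim x)
        have w_nonneg: "0 \<le> indicator {0..L} x *\<^sub>R ?w x" by (simp add: indicator_def)
        have h_nonneg: "0 \<le> L ^ k * h * \<nu>' x"
          using L C0(1) I_nonneg[of t] \<nu>'(2)[of x] by (simp add: h_def)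
        show ?case
        proof (cases "\<nu>' x = 0")
          case True
          then show ?thesis using w_nonneg D by simp
        next
          case False
          with elim have x: "0 < x" "x < L" by auto
          let ?y = "(poly (?P t) x)\<^sup>2"
          have ind: "indicator {0..L} x *\<^sub>R ?w x = ?y * (x powr (\<beta> - 1) * (L - x) powr \<tau>)"
            using x by simp
          consider "x < \<epsilon>" | "L - \<epsilon> < x" | "x \<in> {\<epsilon>..L - \<epsilon>}" by fastforce
          then show ?thesis
          proof cases
            case 1
            have "m1 \<le> (L - x) powr \<tau>"
              unfolding m1_def using 1 x \<nu>'(5) L by (intro powr_ge_min) auto
            then have one_le: "1 \<le> (L - x) powr \<tau> / m1" using m by simp
            have "\<nu>' x * poly q x \<le> (C * x powr \<xi>) * (x ^ k * ?y)"
              unfolding q using \<nu>'(9)[of x] x 1 by (intro mult_right_mono) auto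
            also have "\<dots> = C * (?y * x powr (\<beta> - 1)) * 1"
              using x by (simp add: \<beta>_def powr_add powr_realpow mult_ac)
            also have "\<dots> \<le> C * (?y * x powr (\<beta> - 1)) * ((L - x) powr \<tau> / m1)"
              using \<nu>'(7) one_le by (intro mult_left_mono) auto
            also have "\<dots> = C / m1 * (indicator {0..L} x *\<^sub>R ?w x)" unfolding ind by simp
            also have "\<dots> \<le> D * (indicator {0..L} x *\<^sub>R ?w x)"
              unfolding D_def using m \<nu>'(7) L by (intro mult_right_mono w_nonneg) auto
            finally show ?thesis using h_nonneg by linarith
          next
            case 2
            have "m2 \<le> x powr (\<beta> - 1)"
              unfolding m2_def using 2 x \<nu>'(5) L by (intro powr_ge_min) auto
            then have one_le: "1 \<le> x powr (\<beta> - 1) / m2" using m by simp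
            have "\<nu>' x * poly q x \<le> (C * (L - x) powr \<tau>) * (L ^ k * ?y)"
              unfolding q using \<nu>'(10)[of x] x 2 \<nu>'(7) L by (intro mult_mono[of "\<nu>' x"] mult_right_mono power_mono) auto
            also have "\<dots> = C * (L - x) powr \<tau> * L ^ k * ?y * 1" by simp
            also have "\<dots> \<le> C * (L - x) powr \<tau> * L ^ k * ?y * (x powr (\<beta> - 1) / m2)"
              using \<nu>'(7) one_le L by (intro mult_left_mono) auto
            also have "\<dots> = C * L ^ k / m2 * (indicator {0..L} x *\<^sub>R ?w x)"
              unfolding ind by (simp add: mult_ac)
            also have "\<dots> \<le> D * (indicator {0..L} x *\<^sub>R ?w x)"
              unfolding D_def using m \<nu>'(7) L by (intro mult_right_mono w_nonneg) auto
            finally show ?thesis using h_nonneg by linarith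
          next
            case 3
            have "poly q x \<le> L ^ k * h"
              unfolding q using h[OF 3] x by (intro mult_mono power_mono) auto
            then have "\<nu>' x * poly q x \<le> L ^ k * h * \<nu>' x"
              using \<nu>'(2)[of x] by (metis mult.commute mult_left_mono)
            moreover have "0 \<le> D * (indicator {0..L} x *\<^sub>R ?w x)" using D w_nonneg by (rule mult_nonneg_nonneg)
            ultimately show ?thesis by linarith
          qed
        qed
      qed
    qed
    also have "\<dots> = D * ?I t + L ^ k * h"
    proof -
      have "(LINT x|lborel. D * (indicator {0..L} x *\<^sub>R ?w x) + L ^ k * h * \<nu>' x)
        = (LINT x|lborel. D * (indicator {0..L} x *\<^sub>R ?w x)) + (LINT x|lborel. L ^ k * h * \<nu>' x)"
        using one by (intro Bochner_Integration.integral_add integrable_mult_right int_w)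
          (simp add: has_bochner_integral_iff)
      also have "(LINT x|lborel. L ^ k * h * \<nu>' x) = L ^ k * h"
        using one by (simp add: has_bochner_integral_iff)
      also have "(LINT x|lborel. D * (indicator {0..L} x *\<^sub>R ?w x)) = D * ?I t"
        by (subst sq[symmetric]) (simp add: jacobi_integral_def set_lebesgue_integral_def)
      finally show ?thesis .
    qed
    finally show ?thesis by (simp add: q h_def algebra_simps)
  qed
  have "(\<lambda>t. \<integral>x. x ^ k * (poly (?P t) x)\<^sup>2 \<partial>\<nu>) \<in> O(?I)"
  proof (rule bigoI, rule eventually_mono[OF eventually_ge_at_top[of 1]])
    fix t :: nat assume t: "1 \<le> t"
    have ae: "AE x in \<nu>. x \<in> {0<..L}" using edge by (simp add: edge_distribution_def)
    have "0 \<le> (\<integral>x. x ^ k * (poly (?P t) x)\<^sup>2 \<partial>\<nu>)"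
      using ae by (intro integral_nonneg_AE) (auto elim: eventually_mono)
    then show "norm (\<integral>x. x ^ k * (poly (?P t) x)\<^sup>2 \<partial>\<nu>) \<le> (D + L ^ k * C0 * L) * norm (?I t)"
      using bound[OF t] I_nonneg[of t] by simp
  qed
  also have "?I \<in> O(\<lambda>t. real t powr (- 2 * \<beta>))"
    by (rule bigthetaD1[OF jacobi_integral_jacobi_poly_bigtheta[OF L \<tau> \<beta>(1)]])
  finally show ?thesis by (simp add: \<beta>_def)
qed

section \<open>The spectral theorem for symmetric matrices\<close>

lemma symmetric_matrix_inner:
  fixes A :: "real ^ 'n ^ 'n"
  assumes "transpose A = A"
  shows "(A *v x) \<bullet> y = x \<bullet> (A *v y)"
  using dot_lmul_matrix[of x A y] transpose_matrix_vector[of A x] assms by simp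

text \<open>The maximiser \<open>u\<close> of the Rayleigh quotient is a zero of the positive semidefinite form
  \<open>\<mu> |v|\<^sup>2 - v \<bullet> A v\<close>, hence in its radical.\<close>

lemma symmetric_matrix_eigenvector_in_subspace:
  fixes A :: "real ^ 'n ^ 'n"
  assumes sym: "transpose A = A" and S: "subspace S" "\<And>x. x \<in> S \<Longrightarrow> A *v x \<in> S"
    and nontrivial: "x0 \<in> S" "x0 \<noteq> 0"
  obtains u \<mu> where "u \<in> S" "norm u = 1" "A *v u = \<mu> *\<^sub>R u"
proof -
  let ?g = "\<lambda>v. v \<bullet> (A *v v)"
  have compact: "compact (S \<inter> sphere 0 1)"
    using closed_subspace[OF S(1)] by (intro closed_Int_compact) auto
  have "(1 / norm x0) *\<^sub>R x0 \<in> S \<inter> sphere 0 1"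
    using nontrivial S(1) by (simp add: subspace_scale)
  then have nonempty: "S \<inter> sphere 0 1 \<noteq> {}" by blast
  have "continuous_on (S \<inter> sphere 0 1) ?g"
    by (intro continuous_intros matrix_vector_mult_linear_continuous_on)
  then obtain u where "u \<in> S \<inter> sphere 0 1" "\<forall>v\<in>S \<inter> sphere 0 1. ?g v \<le> ?g u"
    using continuous_attains_sup[OF compact nonempty] by blast
  then have u: "u \<in> S" "norm u = 1" and max: "\<And>v. v \<in> S \<Longrightarrow> norm v = 1 \<Longrightarrow> ?g v \<le> ?g u"
    by auto
  define \<mu> where "\<mu> = ?g u"
  have psd: "?g v \<le> \<mu> * (v \<bullet> v)" if v: "v \<in> S" for v
  proof (cases "v = 0")
    case False
    have le: "?g ((1 / norm v) *\<^sub>R v) \<le> \<mu>"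
      unfolding \<mu>_def using False v S(1) by (intro max) (auto simp: subspace_scale)
    have eq: "?g ((1 / norm v) *\<^sub>R v) = ?g v / (v \<bullet> v)"
      by (simp add: matrix_vector_mult_scaleR power2_norm_eq_inner[symmetric] power2_eq_square)
    show ?thesis using le[unfolded eq] False by (simp add: pos_divide_le_eq)
  qed simp
  have orth: "(\<mu> *\<^sub>R u - A *v u) \<bullet> v = 0" if v: "v \<in> S" for v
  proof (rule ccontr)
    define b where "b = (\<mu> *\<^sub>R u - A *v u) \<bullet> v"
    define a where "a = \<mu> * (v \<bullet> v) - ?g v"
    assume "(\<mu> *\<^sub>R u - A *v u) \<bullet> v \<noteq> 0"
    then have b: "b \<noteq> 0" by (simp add: b_def)
    have a: "0 \<le> a" using psd[OF v] by (simp add: a_def)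
    have uu: "u \<bullet> u = 1" using u by (simp add: norm_eq_1)
    have quad: "0 \<le> 2 * r * b + r\<^sup>2 * a" for r
    proof -
      have "0 \<le> \<mu> * ((u + r *\<^sub>R v) \<bullet> (u + r *\<^sub>R v)) - ?g (u + r *\<^sub>R v)"
        using psd[of "u + r *\<^sub>R v"] u v S(1) by (simp add: subspace_add subspace_scale)
      also have "?g (u + r *\<^sub>R v) = ?g u + 2 * r * ((A *v u) \<bullet> v) + r\<^sup>2 * ?g v"
        using symmetric_matrix_inner[OF sym, of u v]
        by (simp add: matrix_vector_right_distrib matrix_vector_mult_scaleR inner_add_left
            inner_add_right inner_commute power2_eq_square algebra_simps)
      also have "(u + r *\<^sub>R v) \<bullet> (u + r *\<^sub>R v) = 1 + 2 * r * (u \<bullet> v) + r\<^sup>2 * (v \<bullet> v)"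
        using uu by (simp add: inner_add_left inner_add_right inner_commute power2_eq_square algebra_simps)
      finally show ?thesis
        by (simp add: b_def a_def \<mu>_def inner_diff_left algebra_simps)
    qed
    \<comment> \<open>\<open>a + 1\<close> instead of the minimiser's \<open>a\<close>, so that
      \<open>r = - b / s\<close> makes sense also for \<open>a = 0\<close>; the quadratic is
      negative there because \<open>2 * s - a = a + 2\<close>.\<close>
    define s where "s = a + 1"
    have s: "0 < s" using a by (simp add: s_def)
    have "0 \<le> (2 * (- b / s) * b + (- b / s)\<^sup>2 * a) * s\<^sup>2"
      using quad[of "- b / s"] by (intro mult_nonneg_nonneg) auto
    also have "\<dots> = - (b\<^sup>2 * (2 * s - a))"
      using s by (simp add: power2_eq_square field_simps)
    finally have "b\<^sup>2 * (2 * s - a) \<le> 0" by simp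
    moreover have "0 < b\<^sup>2 * (2 * s - a)" using a b by (simp add: s_def)
    ultimately show False by simp
  qed
  have "\<mu> *\<^sub>R u - A *v u \<in> S" using u S by (simp add: subspace_diff subspace_scale)
  then have "\<mu> *\<^sub>R u - A *v u = 0" using orth by (metis inner_eq_zero_iff)
  then show ?thesis using u by (intro that[of u \<mu>]) auto
qed

text \<open>The dimension of the whole space is fixed by the type, so the induction runs over
  invariant subspaces. By symmetry the orthogonal complement of an eigenvector inside
  \<open>S\<close> is again invariant.\<close>

lemma symmetric_matrix_orthonormal_eigenbasis_subspace:
  fixes A :: "real ^ 'n ^ 'n"
  assumes sym: "transpose A = A"
  shows "subspace S \<Longrightarrow> (\<And>x. x \<in> S \<Longrightarrow> A *v x \<in> S) \<Longrightarrow>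
    \<exists>B. B \<subseteq> S \<and> pairwise orthogonal B \<and> (\<forall>x\<in>B. norm x = 1) \<and> (\<forall>x\<in>B. \<exists>\<mu>. A *v x = \<mu> *\<^sub>R x) \<and> span B = S"
proof (induction "dim S" arbitrary: S rule: less_induct)
  case less
  show ?case
  proof (cases "S \<subseteq> {0}")
    case True
    then have "S = {0}" using subspace_0[OF less.prems(1)] by auto
    then show ?thesis by (intro exI[of _ "{}"]) auto
  next
    case False
    then obtain x0 where "x0 \<in> S" "x0 \<noteq> 0" by auto
    then obtain u \<mu> where u: "u \<in> S" "norm u = 1" "A *v u = \<mu> *\<^sub>R u"
      using symmetric_matrix_eigenvector_in_subspace[OF sym less.prems] by metis
    have uu: "u \<bullet> u = 1" using u by (simp add: norm_eq_1)
    define T where "T = {x \<in> S. u \<bullet> x = 0}"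
    have T: "subspace T" unfolding T_def
      using less.prems(1) by (auto simp: subspace_def inner_add_right)
    have invariant: "A *v x \<in> T" if "x \<in> T" for x
      using that less.prems(2) symmetric_matrix_inner[OF sym, of u x] u by (simp add: T_def)
    have "dim T < dim S"
    proof (rule dim_psubset)
      have spans: "span T = T" "span S = S" using T less.prems(1) by simp_all
      have "u \<notin> T" "T \<subseteq> S" using uu by (auto simp: T_def)
      then show "span T \<subset> span S" unfolding spans using u(1) by auto
    qed
    then obtain B where B: "B \<subseteq> T" "pairwise orthogonal B" "\<And>x. x \<in> B \<Longrightarrow> norm x = 1"
        "\<And>x. x \<in> B \<Longrightarrow> \<exists>\<mu>. A *v x = \<mu> *\<^sub>R x" "span B = T"
      using less.hyps[OF _ T invariant] by blast
    have "S \<subseteq> span (insert u B)"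
    proof
      fix x assume x: "x \<in> S"
      have "x - (u \<bullet> x) *\<^sub>R u \<in> T"
        using x u(1) uu less.prems(1) by (simp add: T_def subspace_diff subspace_scale inner_diff_right)
      then have "x - (u \<bullet> x) *\<^sub>R u \<in> span (insert u B)"
        using B(5) span_mono[of B "insert u B"] by auto
      then have "x - (u \<bullet> x) *\<^sub>R u + (u \<bullet> x) *\<^sub>R u \<in> span (insert u B)"
        by (intro span_add span_scale) (auto intro: span_base)
      then show "x \<in> span (insert u B)" by simp
    qed
    moreover have "insert u B \<subseteq> S" using u(1) B(1) by (auto simp: T_def)
    then have "span (insert u B) \<subseteq> S" using less.prems(1) by (simp add: span_minimal)
    moreover have "pairwise orthogonal (insert u B)"
      using B(1,2) by (auto simp: pairwise_insert orthogonal_def T_def inner_commute)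
    ultimately show ?thesis
      using \<open>insert u B \<subseteq> S\<close> B(3,4) u by (intro exI[of _ "insert u B"]) auto
  qed
qed

theorem symmetric_matrix_orthonormal_eigenbasis:
  fixes A :: "real ^ 'n ^ 'n"
  assumes sym: "transpose A = A"
  obtains f :: "'n \<Rightarrow> real ^ 'n" and e :: "'n \<Rightarrow> real"
  where "\<And>i j. f i \<bullet> f j = (if i = j then 1 else 0)" "\<And>i. A *v f i = e i *\<^sub>R f i"
proof -
  obtain B where B: "pairwise orthogonal B" "\<And>x. x \<in> B \<Longrightarrow> norm x = 1"
      "\<And>x. x \<in> B \<Longrightarrow> \<exists>\<mu>. A *v x = \<mu> *\<^sub>R x" "span B = UNIV"
    using symmetric_matrix_orthonormal_eigenbasis_subspace[OF sym, of UNIV] by auto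
  have "independent B"
    using B(1,2) by (intro pairwise_orthogonal_independent) force+
  then have "finite B" by (rule independent_imp_finite)
  have "card B = dim (span B)"
    using \<open>independent B\<close> by (simp add: dim_eq_card_independent)
  then have "card B = DIM(real ^ 'n)" using B(4) by simp
  then have "card (UNIV :: 'n set) = card B" by simp
  then obtain f where f: "bij_betw f (UNIV :: 'n set) B"
    using \<open>finite B\<close> finite_same_card_bij[of "UNIV :: 'n set" B] by auto
  have fB: "f i \<in> B" for i using f by (auto simp: bij_betw_def)
  obtain e where "\<And>i. A *v f i = e i *\<^sub>R f i" using B(3)[OF fB] by metis
  moreover have "f i \<bullet> f j = (if i = j then 1 else 0)" for i j
  proof (cases "i = j")
    case False
    then have "f i \<noteq> f j" using f by (auto simp: bij_betw_def inj_on_def)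
    then show ?thesis using B(1) fB False by (auto simp: pairwise_def orthogonal_def)
  qed (use B(2)[OF fB] in \<open>simp add: norm_eq_1\<close>)
  ultimately show ?thesis by (rule that[rotated])
qed

text \<open>Indexing by \<open>'n\<close> instead of using sets keeps multiplicities of eigenvalues
  and makes every coordinate sum range over \<open>UNIV\<close>.\<close>

locale orthonormal_eigenbasis =
  fixes A :: "real ^ 'n ^ 'n" and f :: "'n \<Rightarrow> real ^ 'n" and e :: "'n \<Rightarrow> real"
  assumes orthonormal: "f i \<bullet> f j = (if i = j then 1 else 0)"
    and eigenvector: "A *v f i = e i *\<^sub>R f i"
begin

text \<open>For a square matrix a right inverse is a left inverse; applied to the matrix with rows
  \<open>f i\<close>, this turns orthonormality into completeness.\<close>

lemma expansion: "x = (\<Sum>i\<in>UNIV. (x \<bullet> f i) *\<^sub>R f i)"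
proof -
  define Q where "Q = (\<chi> i. f i)"
  have "Q ** transpose Q = mat 1"
    by (simp add: matrix_matrix_mult_def mat_def vec_eq_iff transpose_def Q_def
        orthonormal[unfolded inner_vec_def inner_real_def])
  then have "transpose Q ** Q = mat 1" by (simp add: matrix_left_right_inverse)
  then have "x = transpose Q *v (Q *v x)" by (simp add: matrix_vector_mul_assoc)
  also have "Q *v x = (\<chi> i. x \<bullet> f i)"
    by (simp add: matrix_vector_mult_def Q_def inner_vec_def mult.commute)
  also have "transpose Q *v \<dots> = (\<Sum>i\<in>UNIV. (x \<bullet> f i) *\<^sub>R f i)"
    by (simp add: matrix_vector_mult_def transpose_def Q_def vec_eq_iff mult.commute)
  finally show ?thesis .
qed

lemma parseval: "x \<bullet> y = (\<Sum>i\<in>UNIV. (x \<bullet> f i) * (y \<bullet> f i))"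
  by (subst expansion[of y]) (simp add: inner_sum_right mult.commute)

lemma eq_by_coordinates:
  assumes "\<And>i. x \<bullet> f i = y \<bullet> f i"
  shows "x = y"
proof -
  have "x = (\<Sum>i\<in>UNIV. (x \<bullet> f i) *\<^sub>R f i)" by (rule expansion)
  also have "\<dots> = y" unfolding assms by (rule expansion[symmetric])
  finally show ?thesis .
qed

lemma poly_matrix_eigenvector: "poly_matrix p A *v f i = poly p (e i) *\<^sub>R f i"
proof -
  have pow: "((**) A ^^ k) (mat 1) *v f i = (e i ^ k) *\<^sub>R f i" for k
    by (induction k)
      (simp_all add: matrix_vector_mul_assoc[symmetric] matrix_vector_mult_scaleR eigenvector)
  have sum_mv: "(\<Sum>k\<in>S. B k) *v x = (\<Sum>k\<in>S. B k *v x)" if "finite S" for S and B :: "nat \<Rightarrow> real ^ 'n ^ 'n" and x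
    using that by induction (simp_all add: matrix_vector_mult_add_rdistrib)
  show ?thesis
    unfolding poly_matrix_def sum_mv[OF finite_atMost]
    by (simp add: scaleR_matrix_vector_assoc[symmetric] pow poly_altdef scaleR_sum_left)
qed

lemma inner_poly_matrix: "(poly_matrix p A *v x) \<bullet> f i = poly p (e i) * (x \<bullet> f i)"
proof -
  have "poly_matrix p A *v x = (\<Sum>j\<in>UNIV. (x \<bullet> f j) *\<^sub>R (poly_matrix p A *v f j))"
    by (subst expansion[of x]) (simp add: linear_sum[OF matrix_vector_mul_linear] matrix_vector_mult_scaleR)
  then show ?thesis
    by (simp add: poly_matrix_eigenvector inner_sum_left orthonormal if_distrib cong: if_cong)
qed

lemma inner_mult: "(A *v x) \<bullet> f i = e i * (x \<bullet> f i)"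
proof -
  have "A *v x = (\<Sum>j\<in>UNIV. (x \<bullet> f j) *\<^sub>R (A *v f j))"
    by (subst expansion[of x]) (simp add: linear_sum[OF matrix_vector_mul_linear] matrix_vector_mult_scaleR)
  then show ?thesis
    by (simp add: eigenvector inner_sum_left orthonormal if_distrib cong: if_cong)
qed

lemma poly_matrix_quadratic_form:
  "x \<bullet> (poly_matrix p A *v x) = (\<Sum>i\<in>UNIV. poly p (e i) * (x \<bullet> f i)\<^sup>2)"
  by (subst parseval) (simp add: inner_poly_matrix power2_eq_square mult_ac)

lemma poly_matrix_entry: "poly_matrix p A $ i $ j = (\<Sum>k\<in>UNIV. poly p (e k) * (f k $ i * f k $ j))"
proof -
  have "poly_matrix p A $ i $ j = axis i 1 \<bullet> (poly_matrix p A *v axis j 1)"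
    by (simp add: inner_axis' matrix_vector_mult_basis column_def)
  also have "\<dots> = (\<Sum>k\<in>UNIV. poly p (e k) * (f k $ i * f k $ j))"
    by (subst parseval) (simp add: inner_poly_matrix inner_axis' mult_ac)
  finally show ?thesis .
qed

lemma trace_poly_matrix: "trace (poly_matrix p A) = (\<Sum>k\<in>UNIV. poly p (e k))"
proof -
  have "trace (poly_matrix p A) = (\<Sum>k\<in>UNIV. \<Sum>i\<in>UNIV. poly p (e k) * (f k $ i * f k $ i))"
    unfolding trace_def poly_matrix_entry by (rule sum.swap)
  also have "\<dots> = (\<Sum>k\<in>UNIV. poly p (e k) * (f k \<bullet> f k))"
    by (simp add: sum_distrib_left inner_vec_def)
  finally show ?thesis by (simp add: orthonormal)
qed

text \<open>Components of unit vectors have modulus at most 1. This carries bounds on the spectrum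
  over to matrix entries, and thereby gives their integrability.\<close>

lemma abs_poly_matrix_entry_le: "\<bar>poly_matrix p A $ i $ j\<bar> \<le> (\<Sum>k\<in>UNIV. \<bar>poly p (e k)\<bar>)"
proof -
  have "\<bar>f k $ i\<bar> \<le> 1" for k i
    using component_le_norm_cart[of "f k" i] orthonormal[of k k] by (simp add: norm_eq_1[symmetric])
  then have "\<bar>f k $ i * f k $ j\<bar> \<le> 1" for k
    by (simp add: abs_mult mult_le_one)
  then have "\<bar>poly p (e k) * (f k $ i * f k $ j)\<bar> \<le> \<bar>poly p (e k)\<bar>" for k
    using mult_left_mono[of "\<bar>f k $ i * f k $ j\<bar>" 1 "\<bar>poly p (e k)\<bar>"] by (simp add: abs_mult)
  then show ?thesis
    unfolding poly_matrix_entry by (intro order_trans[OF sum_abs sum_mono]) auto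
qed

text \<open>Evaluation at a real \<open>x\<close> moves the determinant from polynomials to reals,
  where the eigenvector matrix \<open>T\<close> intertwines \<open>B\<close> with the diagonal
  matrix \<open>D\<close> and can be cancelled.\<close>

lemma charpoly_eq: "charpoly A = (\<Prod>i\<in>UNIV. [:- e i, 1:])"
proof (rule poly_ext)
  fix x :: real
  define B where "B = (\<chi> i j. (if i = j then x else 0) - A $ i $ j)"
  define T where "T = (\<chi> i j. f j $ i)"
  define D where "D = (\<chi> i j. if i = j then x - e i else (0 :: real))"
  have "poly (charpoly A) x = det B"
    unfolding charpoly_def det_def B_def
    by (simp add: poly_sum poly_prod if_distrib[of "\<lambda>p. poly p x"] cong: if_cong)
  have "B ** T = T ** D"
  proof -
    have "(B ** T) $ i $ j = x * f j $ i - (A *v f j) $ i" for i j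
      by (simp add: B_def T_def matrix_matrix_mult_def matrix_vector_mult_def left_diff_distrib
          sum_subtractf if_distrib[of "\<lambda>c. c * _"] cong: if_cong)
    moreover have "(T ** D) $ i $ j = (x - e j) * f j $ i" for i j
      by (simp add: D_def T_def matrix_matrix_mult_def if_distrib[of "\<lambda>c. _ * c"] mult.commute cong: if_cong)
    ultimately have "(B ** T) $ i $ j = (T ** D) $ i $ j" for i j
      by (simp add: eigenvector left_diff_distrib)
    then show ?thesis by (simp add: vec_eq_iff)
  qed
  then have "det B * det T = det T * det D" by (metis det_mul)
  moreover have "transpose T ** T = mat 1"
    by (simp add: matrix_matrix_mult_def mat_def vec_eq_iff transpose_def T_def
        orthonormal[unfolded inner_vec_def inner_real_def])
  then have "det T \<noteq> 0" by (metis det_I det_mul mult_zero_right zero_neq_one)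
  ultimately have "det B = det D" by simp
  also have "\<dots> = (\<Prod>i\<in>UNIV. x - e i)" by (subst det_diagonal) (simp_all add: D_def)
  finally show "poly (charpoly A) x = poly (\<Prod>i\<in>UNIV. [:- e i, 1:]) x"
    using \<open>poly (charpoly A) x = det B\<close> by (simp add: poly_prod)
qed

lemma eigenvalues_eq: "eigenvalues A = image_mset e (mset_set UNIV)"
proof -
  have "proots (\<Prod>i\<in>S. [:- e i, 1:]) = image_mset e (mset_set S)" if "finite S" for S
    using that by induction (simp_all add: proots_mult del: mult_pCons_left)
  then show ?thesis by (simp add: eigenvalues_def charpoly_eq)
qed

text \<open>The uniform distribution on the multiset of eigenvalues is the image under
  \<open>e\<close> of the uniform distribution on indices.\<close>

lemma nn_integral_spectral_measure:
  assumes "g \<in> borel_measurable borel"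
  shows "(\<integral>\<^sup>+x. g x \<partial>spectral_measure A) = (\<Sum>i\<in>UNIV. g (e i)) / of_nat CARD('n)"
proof -
  have "(\<integral>\<^sup>+x. g x \<partial>spectral_measure A) = (\<integral>\<^sup>+x. g x \<partial>measure_pmf (map_pmf e (pmf_of_set UNIV)))"
    using assms unfolding spectral_measure_def eigenvalues_eq
    by (subst nn_integral_distr) (simp_all add: map_pmf_of_set)
  also have "\<dots> = (\<Sum>i\<in>UNIV. g (e i)) / of_nat CARD('n)"
    by (simp add: nn_integral_pmf_of_set)
  finally show ?thesis .
qed

end

lemma sym_pos_def_orthonormal_eigenbasis:
  fixes A :: "real ^ 'n ^ 'n"
  assumes "sym_pos_def A"
  obtains f e where "orthonormal_eigenbasis A f e" "\<And>i. 0 < e i"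
proof -
  have sym: "transpose A = A" using assms by (simp add: sym_pos_def_def)
  obtain f :: "'n \<Rightarrow> real ^ 'n" and e
    where "\<And>i j. f i \<bullet> f j = (if i = j then 1 else 0)" "\<And>i. A *v f i = e i *\<^sub>R f i"
    by (rule symmetric_matrix_orthonormal_eigenbasis[OF sym], rule that)
  then interpret orthonormal_eigenbasis A f e by unfold_locales
  have "0 < e i" for i
  proof -
    have "f i \<noteq> 0" using orthonormal[of i i] by auto
    then have "0 < f i \<bullet> (A *v f i)" using assms by (simp add: sym_pos_def_def)
    then show ?thesis by (simp add: eigenvector orthonormal)
  qed
  with orthonormal_eigenbasis_axioms show ?thesis by (rule that)
qed

section \<open>Residual polynomials\<close>

text \<open>The recursion of \<open>iterate\<close> for the error vector, with multiplication by the
  variable in place of the gradient and 1 in place of the initial error.\<close>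

fun residual_poly :: "(nat \<Rightarrow> nat \<Rightarrow> real) \<Rightarrow> nat \<Rightarrow> real poly" where
  "residual_poly c t = 1 + [:0, 1:] * (\<Sum>s\<in>{..<t}. smult (c t s) (residual_poly c s))"

declare residual_poly.simps [simp del]

lemma poly_residual_poly_0: "poly (residual_poly c t) 0 = 1"
  by (subst residual_poly.simps) simp

lemma degree_residual_poly_le: "degree (residual_poly c t) \<le> t"
proof (induction t rule: less_induct)
  case (less t)
  let ?S = "\<Sum>s<t. smult (c t s) (residual_poly c s)"
  \<comment> \<open>At \<open>t = 0\<close> the truncated \<open>t - 1\<close> would only give
    degree at most 1; there the sum is empty.\<close>
  show ?case
  proof (cases "t = 0")
    case True
    then show ?thesis by (subst residual_poly.simps) simp
  next
    case False
    have "degree ?S \<le> t - 1"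
    proof (rule degree_sum_le)
      fix s assume "s \<in> {..<t}"
      then show "degree (smult (c t s) (residual_poly c s)) \<le> t - 1"
        using less[of s] degree_smult_le[of "c t s" "residual_poly c s"] by auto
    qed simp
    then have "degree ([:0, 1:] * ?S) \<le> t"
      using False degree_mult_le[of "[:0, 1:]" ?S] by simp
    then show ?thesis by (subst residual_poly.simps) (intro degree_add_le, auto)
  qed
qed

text \<open>The quotient of \<open>P t - 1\<close> by x has degree below \<open>t\<close>, hence
  expands in the earlier members of the graded family. The coordinates are the update
  coefficients.\<close>

lemma residual_poly_surj:
  assumes P: "\<And>t. degree (P t) = t" "\<And>t. poly (P t) 0 = 1"
  obtains c where "residual_poly c = P"
proof -
  have "\<exists>a. P t = 1 + [:0, 1:] * (\<Sum>s<t. smult (a s) (P s))" for t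
  proof -
    have "poly (P t - 1) 0 = 0" using P by simp
    then have "[:0, 1:] dvd P t - 1" using poly_eq_0_iff_dvd[of "P t - 1" 0] by simp
    then obtain r where r: "P t - 1 = [:0, 1:] * r" by (rule dvdE)
    have "\<exists>a. r = (\<Sum>s<t. smult (a s) (P s))"
    proof (cases "r = 0")
      case True
      then show ?thesis by (intro exI[of _ "\<lambda>_. 0"]) simp
    next
      case False
      then have "Suc (degree r) = degree (P t - 1)" unfolding r by simp
      also have "\<dots> \<le> t" using P by (intro degree_diff_le) auto
      finally have "degree r < t" by simp
      moreover have "P 0 \<noteq> 0" using P(2)[of 0] by auto
      ultimately show ?thesis using poly_in_span_of_graded[OF P(1)] by metis
    qed
    then show ?thesis using r by (metis add_diff_cancel_left' diff_add_cancel add.commute)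
  qed
  then obtain c where c: "\<And>t. P t = 1 + [:0, 1:] * (\<Sum>s<t. smult (c t s) (P s))" by metis
  have "residual_poly c t = P t" for t
  proof (induction t rule: less_induct)
    case (less t)
    then show ?case by (subst residual_poly.simps, subst c) simp
  qed
  then show ?thesis by (intro that[of c]) auto
qed

text \<open>Symmetry merges the two terms of the product rule; uniqueness is shown as well because
  \<open>gradient\<close> is a definite description.\<close>

lemma gradient_quadratic:
  fixes A :: "real ^ 'n ^ 'n"
  assumes "transpose A = A"
  shows "gradient (quadratic A ys) x = A *v (x - ys)"
  unfolding gradient_def
proof (rule the_equality)
  have "(quadratic A ys has_derivative
      (\<lambda>h. (1 / 2) * ((x - ys) \<bullet> (A *v h) + h \<bullet> (A *v (x - ys))))) (at x)"
    unfolding quadratic_def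
    by (auto intro!: derivative_eq_intros has_derivative_compose[of _ _ _ _ "(*v) A"]
        bounded_linear.has_derivative[OF matrix_vector_mul_bounded_linear])
  moreover have "(1 / 2) * ((x - ys) \<bullet> (A *v h) + h \<bullet> (A *v (x - ys))) = h \<bullet> (A *v (x - ys))" for h
    using symmetric_matrix_inner[OF assms, of "x - ys" h] by (simp add: inner_commute)
  ultimately show deriv: "GDERIV (quadratic A ys) x :> A *v (x - ys)"
    by (simp add: gderiv_def)
  fix D assume "GDERIV (quadratic A ys) x :> D"
  then have "(\<lambda>h. h \<bullet> D) = (\<lambda>h. h \<bullet> (A *v (x - ys)))"
    using deriv unfolding gderiv_def by (rule has_derivative_unique)
  then have "\<forall>h. h \<bullet> D = h \<bullet> (A *v (x - ys))" by metis
  then show "D = A *v (x - ys)" by (simp add: vector_eq_ldot)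
qed

context orthonormal_eigenbasis
begin

text \<open>In coordinates of the eigenbasis every polynomial in \<open>A\<close> acts as
  multiplication by a real number, which reduces the claim to the recursion of
  \<open>residual_poly\<close> evaluated at an eigenvalue.\<close>

lemma iterate_eq:
  assumes sym: "transpose A = A"
  shows "iterate c (quadratic A ys) y0 t - ys = poly_matrix (residual_poly c t) A *v (y0 - ys)"
proof (induction t rule: less_induct)
  case (less t)
  let ?z = "y0 - ys"
  have "iterate c (quadratic A ys) y0 t - ys
      = ?z + (\<Sum>s<t. c t s *\<^sub>R (A *v (iterate c (quadratic A ys) y0 s - ys)))"
    by (subst iterate.simps) (simp add: gradient_quadratic[OF sym])
  also have "\<dots> = ?z + (\<Sum>s<t. c t s *\<^sub>R (A *v (poly_matrix (residual_poly c s) A *v ?z)))"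
    using less by simp
  also have "\<dots> = poly_matrix (residual_poly c t) A *v ?z"
  proof (rule eq_by_coordinates)
    fix i
    have "(?z + (\<Sum>s<t. c t s *\<^sub>R (A *v (poly_matrix (residual_poly c s) A *v ?z)))) \<bullet> f i
      = (1 + e i * (\<Sum>s<t. c t s * poly (residual_poly c s) (e i))) * (?z \<bullet> f i)"
      by (simp add: inner_add_left inner_sum_left inner_mult inner_poly_matrix sum_distrib_left
          distrib_left distrib_right mult_ac)
    also have "1 + e i * (\<Sum>s<t. c t s * poly (residual_poly c s) (e i)) = poly (residual_poly c t) (e i)"
      by (subst residual_poly.simps[of c t]) (simp add: poly_sum)
    finally show "(?z + (\<Sum>s<t. c t s *\<^sub>R (A *v (poly_matrix (residual_poly c s) A *v ?z)))) \<bullet> f i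
      = (poly_matrix (residual_poly c t) A *v ?z) \<bullet> f i"
      by (simp only: inner_poly_matrix)
  qed
  finally show ?case .
qed

text \<open>The objective contributes one factor of the eigenvalue, the squared gradient norm two;
  hence the exponents 1 and 2 of x. Both become a quadratic form in the initial error, so a single
  expectation formula covers them.\<close>

lemma quadratic_gap_eq:
  assumes "x - ys = poly_matrix p A *v z"
  shows "quadratic A ys x - quadratic A ys ys = (1 / 2) * (z \<bullet> (poly_matrix (monom 1 1 * p\<^sup>2) A *v z))"
proof -
  have "(x - ys) \<bullet> (A *v (x - ys)) = z \<bullet> (poly_matrix (monom 1 1 * p\<^sup>2) A *v z)"
    unfolding poly_matrix_quadratic_form
    by (subst parseval) (simp add: assms inner_mult inner_poly_matrix poly_monom power2_eq_square mult_ac)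
  then show ?thesis by (simp add: quadratic_def)
qed

lemma sq_norm_gradient_eq:
  assumes "transpose A = A" "x - ys = poly_matrix p A *v z"
  shows "(norm (gradient (quadratic A ys) x))\<^sup>2 = z \<bullet> (poly_matrix (monom 1 2 * p\<^sup>2) A *v z)"
  unfolding poly_matrix_quadratic_form gradient_quadratic[OF assms(1)] power2_norm_eq_inner
  by (subst parseval)
    (simp add: assms(2) inner_mult inner_poly_matrix poly_monom power2_eq_square mult_ac)

end

section \<open>Expected spectral distribution\<close>

text \<open>The ramps \<open>g n\<close> are eventually equal to the indicator at each point, with
  value 0 at \<open>a\<close> itself. Weierstrass approximates \<open>g n\<close> within
  \<open>1 / Suc n\<close> on a window growing with \<open>n\<close>, which eventually contains any
  given point.\<close>

lemma polynomials_tendsto_indicator_lessThan: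
  fixes a :: real
  obtains p :: "nat \<Rightarrow> real poly" where "\<And>x. (\<lambda>n. poly (p n) x) \<longlonglongrightarrow> indicator {..<a} x"
proof -
  define g where "g = (\<lambda>(n::nat) x. max 0 (min 1 (real n * (a - x))))"
  have "\<exists>q. \<forall>x\<in>{- real n..real n}. \<bar>g n x - poly q x\<bar> < 1 / Suc n" for n
  proof -
    have "continuous_on {- real n..real n} (g n)" unfolding g_def by (intro continuous_intros)
    then obtain h where h: "real_polynomial_function h"
        "\<And>x. x \<in> {- real n..real n} \<Longrightarrow> \<bar>g n x - h x\<bar> < 1 / Suc n"
      using Stone_Weierstrass_real_polynomial_function[of "{- real n..real n}" "g n" "1 / Suc n"] by auto
    obtain b m where "h = (\<lambda>x. \<Sum>i\<le>m::nat. b i * x ^ i)"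
      using real_polynomial_function_imp_sum[OF h(1)] by blast
    then have "h x = poly (\<Sum>i\<le>m. monom (b i) i) x" for x by (simp add: poly_sum poly_monom)
    with h(2) show ?thesis by (intro exI[of _ "\<Sum>i\<le>m. monom (b i) i"]) auto
  qed
  then obtain p where p: "\<And>n x. x \<in> {- real n..real n} \<Longrightarrow> \<bar>g n x - poly (p n) x\<bar> < 1 / Suc n"
    by metis
  have "(\<lambda>n. poly (p n) x) \<longlonglongrightarrow> indicator {..<a} x" for x
  proof -
    have "eventually (\<lambda>n. g n x = indicator {..<a} x) sequentially"
    proof (cases "x < a")
      case True
      have "eventually (\<lambda>n. 1 / (a - x) \<le> real n) sequentially"
        by (rule eventually_compose_filterlim[OF eventually_ge_at_top filterlim_real_sequentially])
      then show ?thesis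
        by eventually_elim (use True in \<open>auto simp: g_def field_simps\<close>)
    next
      case False
      then have "real n * (a - x) \<le> 0" for n by (simp add: mult_nonneg_nonpos)
      then have "g n x = 0" for n unfolding g_def by (intro max_absorb1 min.coboundedI2)
      then show ?thesis using False by simp
    qed
    moreover have "eventually (\<lambda>n. \<bar>x\<bar> \<le> real n) sequentially"
      by (rule eventually_compose_filterlim[OF eventually_ge_at_top filterlim_real_sequentially])
    ultimately have "eventually (\<lambda>n. norm (poly (p n) x - indicator {..<a} x) \<le> 1 / Suc n) sequentially"
    proof eventually_elim
      case (elim n)
      then have "x \<in> {- real n..real n}" by auto
      then show ?case using p[of x n] elim(1) by (simp add: abs_minus_commute)
    qed
    then have "(\<lambda>n. poly (p n) x - indicator {..<a} x) \<longlonglongrightarrow> 0"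
      by (rule Lim_null_comparison) (rule LIMSEQ_inverse_real_of_nat[unfolded inverse_eq_divide])
    then show ?thesis by (simp add: LIM_zero_iff)
  qed
  then show ?thesis by (rule that)
qed

lemma continuous_on_poly_matrix_entry:
  "continuous_on UNIV (\<lambda>A :: real ^ 'n ^ 'n. poly_matrix p A $ i $ j)"
proof -
  have pow: "continuous_on UNIV (\<lambda>A :: real ^ 'n ^ 'n. (((**) A) ^^ k) (mat 1) $ i $ j)" for k i j
  proof (induction k arbitrary: i j)
    case (Suc k)
    have "continuous_on UNIV (\<lambda>A :: real ^ 'n ^ 'n. \<Sum>l\<in>UNIV. A $ i $ l * (((**) A) ^^ k) (mat 1) $ l $ j)"
      by (intro continuous_intros Suc)
    moreover have "(B ** C) $ i $ j = (\<Sum>l\<in>UNIV. B $ i $ l * C $ l $ j)" for B C :: "real ^ 'n ^ 'n"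
      by (simp add: matrix_matrix_mult_def)
    ultimately show ?case by simp
  qed simp
  show ?thesis
    unfolding poly_matrix_def sum_component vector_scaleR_component by (intro continuous_intros pow)
qed

lemma prob_space_spectral_measure: "prob_space (spectral_measure A)"
  unfolding spectral_measure_def by (rule measure_pmf.prob_space_distr) simp

lemma sets_spectral_measure [simp]: "sets (spectral_measure A) = sets borel"
  by (simp add: spectral_measure_def)

section \<open>Expectations of polynomials in the random matrix\<close>

context random_quadratic_problem
begin

lemma measurable_poly_matrix_entry: "(\<lambda>\<omega>. poly_matrix p (H \<omega>) $ i $ j) \<in> borel_measurable M"
  by (rule measurable_compose[OF measurable_H borel_measurable_continuous_onI[OF continuous_on_poly_matrix_entry]])

lemma measurable_trace_poly_matrix: "(\<lambda>\<omega>. trace (poly_matrix p (H \<omega>))) \<in> borel_measurable M"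
  unfolding trace_def by (intro borel_measurable_sum measurable_poly_matrix_entry)

lemma nn_integral_spectral_measure_poly:
  assumes "\<omega> \<in> space M" and nonneg: "\<And>x. 0 < x \<Longrightarrow> 0 \<le> poly q x"
  shows "(\<integral>\<^sup>+x. ennreal (poly q x) \<partial>spectral_measure (H \<omega>)) = ennreal (trace (poly_matrix q (H \<omega>)) / CARD('n))"
    and "0 \<le> trace (poly_matrix q (H \<omega>))"
proof -
  obtain f e where "orthonormal_eigenbasis (H \<omega>) f e" and pos: "\<And>i. 0 < e i"
    using sym_pos_def_orthonormal_eigenbasis[OF sym_pos_def_H[OF assms(1)]] by blast
  then interpret orthonormal_eigenbasis "H \<omega>" f e by simp
  have "0 \<le> poly q (e i)" for i using nonneg pos by simp
  moreover have "poly q \<in> borel_measurable borel"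
    by (intro borel_measurable_continuous_onI continuous_intros)
  then have "(\<lambda>x. ennreal (poly q x)) \<in> borel_measurable borel" by simp
  ultimately show "(\<integral>\<^sup>+x. ennreal (poly q x) \<partial>spectral_measure (H \<omega>))
      = ennreal (trace (poly_matrix q (H \<omega>)) / CARD('n))"
    and "0 \<le> trace (poly_matrix q (H \<omega>))"
    by (simp_all add: nn_integral_spectral_measure trace_poly_matrix sum_ennreal sum_nonneg
        divide_ennreal[symmetric] ennreal_of_nat_eq_real_of_nat)
qed

text \<open>The number of eigenvalues below \<open>a\<close> is a pointwise limit of traces of polynomials in the matrix,
  each of which is continuous; this avoids measurable selections of the eigenvalues.\<close>

lemma measurable_emeasure_spectral_measure_lessThan:
  "(\<lambda>\<omega>. emeasure (spectral_measure (H \<omega>)) {..<a}) \<in> borel_measurable M"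
proof -
  obtain p where p: "\<And>x. (\<lambda>n. poly (p n) x) \<longlonglongrightarrow> indicator {..<a} x"
    using polynomials_tendsto_indicator_lessThan by blast
  let ?F = "\<lambda>\<omega>. measure (spectral_measure (H \<omega>)) {..<a}"
  have "?F \<in> borel_measurable M"
  proof (rule borel_measurable_LIMSEQ_real)
    fix n
    show "(\<lambda>\<omega>. trace (poly_matrix (p n) (H \<omega>)) / CARD('n)) \<in> borel_measurable M"
      by (intro borel_measurable_divide measurable_trace_poly_matrix) simp
  next
    fix \<omega> assume \<omega>: "\<omega> \<in> space M"
    obtain f e where "orthonormal_eigenbasis (H \<omega>) f e"
      using sym_pos_def_orthonormal_eigenbasis[OF sym_pos_def_H[OF \<omega>]] by blast
    then interpret orthonormal_eigenbasis "H \<omega>" f e .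
    have "emeasure (spectral_measure (H \<omega>)) {..<a} = (\<integral>\<^sup>+x. indicator {..<a} x \<partial>spectral_measure (H \<omega>))"
      by simp
    also have "\<dots> = (\<Sum>i\<in>UNIV. indicator {..<a} (e i)) / of_nat CARD('n)"
      by (rule nn_integral_spectral_measure) simp
    also have "\<dots> = ennreal ((\<Sum>i\<in>UNIV. indicator {..<a} (e i)) / CARD('n))"
      by (simp add: divide_ennreal[symmetric] ennreal_of_nat_eq_real_of_nat sum_nonneg
          sum_ennreal[symmetric] ennreal_indicator)
    finally have "?F \<omega> = (\<Sum>i\<in>UNIV. indicator {..<a} (e i)) / CARD('n)"
      by (simp add: measure_def sum_nonneg)
    then show "(\<lambda>n. trace (poly_matrix (p n) (H \<omega>)) / CARD('n)) \<longlonglongrightarrow> ?F \<omega>"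
      unfolding trace_poly_matrix by (auto intro!: tendsto_intros p)
  qed
  then have "(\<lambda>\<omega>. ennreal (?F \<omega>)) \<in> borel_measurable M" by simp
  moreover have "emeasure (spectral_measure A) {..<a} = ennreal (measure (spectral_measure A) {..<a})" for A :: "real ^ 'n ^ 'n"
    using prob_space_spectral_measure[of A]
    by (intro finite_measure.emeasure_eq_measure) (simp add: prob_space_def)
  ultimately show ?thesis by simp
qed

text \<open>Open half-lines form an intersection-stable generator of the Borel sets, so the kernel
  need only be tested on them. The result makes integration against the mixture available.\<close>

lemma measurable_spectral_measure: "(\<lambda>\<omega>. spectral_measure (H \<omega>)) \<in> M \<rightarrow>\<^sub>M subprob_algebra borel"
proof (rule measurable_subprob_algebra_generated[where \<Omega> = UNIV and G = "range lessThan"])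
  show "sets borel = sigma_sets UNIV (range (lessThan :: real \<Rightarrow> real set))"
    by (subst borel_Iio) simp
  show "Int_stable (range (lessThan :: real \<Rightarrow> real set))"
  proof (rule Int_stableI)
    fix A B :: "real set" assume "A \<in> range lessThan" "B \<in> range lessThan"
    then obtain a b where "A = {..<a}" "B = {..<b}" by blast
    then have "A \<inter> B = {..<min a b}" by auto
    then show "A \<inter> B \<in> range lessThan" by blast
  qed
  show "subprob_space (spectral_measure (H \<omega>))" for \<omega>
    by (intro prob_space_imp_subprob_space prob_space_spectral_measure)
  have "emeasure (spectral_measure A) UNIV = 1" for A :: "real ^ 'n ^ 'n"
    using prob_space.emeasure_space_1[OF prob_space_spectral_measure[of A]]
    by (simp add: spectral_measure_def)
  then show "(\<lambda>\<omega>. emeasure (spectral_measure (H \<omega>)) UNIV) \<in> borel_measurable M" by simp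
qed (auto intro: measurable_emeasure_spectral_measure_lessThan)

lemma nn_integral_expected_spectral_distribution:
  assumes "g \<in> borel_measurable borel"
  shows "(\<integral>\<^sup>+x. g x \<partial>expected_spectral_distribution M H)
       = (\<integral>\<^sup>+\<omega>. \<integral>\<^sup>+x. g x \<partial>spectral_measure (H \<omega>) \<partial>M)"
  unfolding expected_spectral_distribution_def
  by (rule nn_integral_bind[OF assms measurable_spectral_measure])

lemma sets_expected_spectral_distribution: "sets (expected_spectral_distribution M H) = sets borel"
  unfolding expected_spectral_distribution_def
  by (rule sets_bind[OF sets_kernel[OF measurable_spectral_measure]]) (auto simp: not_empty)

text \<open>All eigenvalues are positive, so \<open>q\<close> is nonnegative on them and both sides
  can be computed as nonnegative integrals, for which the mixture formula holds.\<close>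

lemma expectation_trace_poly_matrix:
  assumes ae: "AE x in expected_spectral_distribution M H. x \<in> {0<..L}"
    and nonneg: "\<And>x. 0 < x \<Longrightarrow> 0 \<le> poly q x"
  shows "(\<integral>\<omega>. trace (poly_matrix q (H \<omega>)) \<partial>M) = CARD('n) * (\<integral>x. poly q x \<partial>expected_spectral_distribution M H)"
proof -
  let ?\<nu> = "expected_spectral_distribution M H" and ?t = "\<lambda>\<omega>. trace (poly_matrix q (H \<omega>))"
  have meas: "poly q \<in> borel_measurable borel"
    by (intro borel_measurable_continuous_onI continuous_intros)
  have "(\<integral>x. poly q x \<partial>?\<nu>) = enn2real (\<integral>\<^sup>+x. ennreal (poly q x) \<partial>?\<nu>)"
  proof (rule integral_eq_nn_integral)
    show "poly q \<in> borel_measurable ?\<nu>"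
      using meas sets_expected_spectral_distribution by (simp cong: measurable_cong_sets)
    show "AE x in ?\<nu>. 0 \<le> poly q x" using ae by eventually_elim (simp add: nonneg)
  qed
  also have "(\<integral>\<^sup>+x. ennreal (poly q x) \<partial>?\<nu>) = (\<integral>\<^sup>+\<omega>. \<integral>\<^sup>+x. ennreal (poly q x) \<partial>spectral_measure (H \<omega>) \<partial>M)"
    using meas by (intro nn_integral_expected_spectral_distribution) simp
  also have "\<dots> = (\<integral>\<^sup>+\<omega>. ennreal (?t \<omega> / CARD('n)) \<partial>M)"
    by (intro nn_integral_cong nn_integral_spectral_measure_poly(1) nonneg)
  also have "enn2real \<dots> = (\<integral>\<omega>. ?t \<omega> / CARD('n) \<partial>M)"
  proof (rule integral_eq_nn_integral[symmetric])
    show "(\<lambda>\<omega>. ?t \<omega> / CARD('n)) \<in> borel_measurable M"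
      by (intro borel_measurable_divide measurable_trace_poly_matrix) simp
    show "AE \<omega> in M. 0 \<le> ?t \<omega> / CARD('n)"
      by (intro AE_I2 divide_nonneg_nonneg nn_integral_spectral_measure_poly(2) nonneg) simp_all
  qed
  finally show ?thesis by simp
qed

text \<open>The mixture gives no mass to the complement of \<open>{0<..L}\<close>, so almost every
  spectral measure gives it none. As each eigenvalue has positive mass, almost surely all of them
  lie in the interval.\<close>

lemma AE_poly_matrix_entry_bounded:
  assumes ae: "AE x in expected_spectral_distribution M H. x \<in> {0<..L}"
  obtains B where "AE \<omega> in M. \<bar>poly_matrix q (H \<omega>) $ i $ j\<bar> \<le> B"
proof -
  have "bounded (poly q ` {0..L})"
    by (intro compact_imp_bounded compact_continuous_image continuous_intros) auto
  then obtain B where B: "\<And>x. x \<in> {0..L} \<Longrightarrow> \<bar>poly q x\<bar> \<le> B"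
    by (force simp: bounded_iff)
  let ?g = "indicator (- {0<..L}) :: real \<Rightarrow> ennreal"
  have "(\<integral>\<^sup>+x. ?g x \<partial>expected_spectral_distribution M H) = 0"
    using ae sets_expected_spectral_distribution
    by (subst nn_integral_0_iff_AE) (auto cong: measurable_cong_sets elim: eventually_mono)
  then have "(\<integral>\<^sup>+\<omega>. \<integral>\<^sup>+x. ?g x \<partial>spectral_measure (H \<omega>) \<partial>M) = 0"
    by (subst (asm) nn_integral_expected_spectral_distribution) simp_all
  moreover have "(\<lambda>\<omega>. \<integral>\<^sup>+x. ?g x \<partial>spectral_measure (H \<omega>)) \<in> borel_measurable M"
    by (rule measurable_compose[OF measurable_spectral_measure nn_integral_measurable_subprob_algebra]) simp
  ultimately have "AE \<omega> in M. (\<integral>\<^sup>+x. ?g x \<partial>spectral_measure (H \<omega>)) = 0"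
    by (simp add: nn_integral_0_iff_AE)
  with AE_space have "AE \<omega> in M. \<bar>poly_matrix q (H \<omega>) $ i $ j\<bar> \<le> CARD('n) * B"
  proof eventually_elim
    case (elim \<omega>)
    obtain f e where "orthonormal_eigenbasis (H \<omega>) f e"
      using sym_pos_def_orthonormal_eigenbasis[OF sym_pos_def_H[OF elim(1)]] by blast
    then interpret orthonormal_eigenbasis "H \<omega>" f e .
    have "(\<Sum>k\<in>UNIV. ?g (e k)) / of_nat CARD('n) = 0"
      using elim(2) by (subst (asm) nn_integral_spectral_measure) simp_all
    then have "(\<Sum>k\<in>UNIV. ?g (e k)) = 0" by (simp add: ennreal_divide_eq_0_iff)
    then have "?g (e k) = 0" for k by (simp add: sum_nonneg_eq_0_iff)
    then have "0 < e k \<and> e k \<le> L" for k by (auto simp: indicator_def split: if_splits)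
    then have "e k \<in> {0..L}" for k by (simp add: less_imp_le)
    then have "(\<Sum>k\<in>UNIV. \<bar>poly q (e k)\<bar>) \<le> (\<Sum>k\<in>(UNIV :: 'n set). B)" by (intro sum_mono B)
    then show ?case using abs_poly_matrix_entry_le[of q i j] by simp
  qed
  then show ?thesis by (rule that)
qed

text \<open>Written as a double sum over entries, each expectation factors by independence, and the
  identity second moment leaves the diagonal, that is, the trace.\<close>

lemma expectation_quadratic_form:
  assumes ae: "AE x in expected_spectral_distribution M H. x \<in> {0<..L}"
    and nonneg: "\<And>x. 0 < x \<Longrightarrow> 0 \<le> poly q x"
  shows "(\<integral>\<omega>. (x0 \<omega> - xs \<omega>) \<bullet> (poly_matrix q (H \<omega>) *v (x0 \<omega> - xs \<omega>)) \<partial>M)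
       = CARD('n) * (\<integral>x. poly q x \<partial>expected_spectral_distribution M H)"
proof -
  let ?z = "\<lambda>\<omega>. x0 \<omega> - xs \<omega>" and ?B = "\<lambda>\<omega>. poly_matrix q (H \<omega>)"
  have meas_z: "?z \<in> borel_measurable M" using measurable_x0 measurable_xs by simp
  have zz: "has_bochner_integral M (\<lambda>\<omega>. ?z \<omega> $ i * ?z \<omega> $ j) (if i = j then 1 else 0)" for i j
  proof -
    have "bounded_linear (\<lambda>A :: real ^ 'n ^ 'n. A $ i $ j)"
      by (intro bounded_linear_compose[OF bounded_linear_vec_nth bounded_linear_vec_nth])
    from has_bochner_integral_bounded_linear[OF this second_moment] show ?thesis
      by (simp add: mat_def)
  qed
  have int_B: "integrable M (\<lambda>\<omega>. ?B \<omega> $ i $ j)" for i j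
    by (rule AE_poly_matrix_entry_bounded[OF ae, of q i j])
      (rule integrable_const_bound, simp_all add: measurable_poly_matrix_entry)
  have indep_zB: "indep_var borel (\<lambda>\<omega>. ?z \<omega> $ i * ?z \<omega> $ j) borel (\<lambda>\<omega>. ?B \<omega> $ i $ j)" for i j
  proof -
    have g: "(\<lambda>v :: real ^ 'n. v $ i * v $ j) \<in> borel_measurable borel"
      and h: "(\<lambda>A :: real ^ 'n ^ 'n. poly_matrix q A $ i $ j) \<in> borel_measurable borel"
      by (intro borel_measurable_continuous_onI continuous_intros continuous_on_poly_matrix_entry)+
    \<comment> \<open>\<open>indep_var_eq\<close> speaks of generated sigma-algebras. Preimages of
      Borel sets already form one, and those under a measurable function of \<open>Y\<close> are
      among those under \<open>Y\<close>; independence therefore passes from the vector and the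
      matrix to their scalar functions.\<close>
    have sub: "sigma_sets (space M) {(\<lambda>\<omega>. k (Y \<omega>)) -` C \<inter> space M |C. C \<in> sets borel}
        \<subseteq> {Y -` C \<inter> space M |C. C \<in> sets borel}"
      if Y: "Y \<in> borel_measurable M" and k: "k \<in> borel_measurable borel"
      for Y :: "_ \<Rightarrow> 'x :: topological_space" and k :: "'x \<Rightarrow> real"
    proof -
      have "sigma_sets (space M) {(\<lambda>\<omega>. k (Y \<omega>)) -` C \<inter> space M |C. C \<in> sets borel}
         = {(\<lambda>\<omega>. k (Y \<omega>)) -` C \<inter> space M |C. C \<in> sets borel}"
        using sets_vimage_algebra[of "space M" "\<lambda>\<omega>. k (Y \<omega>)" borel]
          sets_vimage_algebra2[of "\<lambda>\<omega>. k (Y \<omega>)" "space M" borel] by simp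
      also have "\<dots> \<subseteq> {Y -` C \<inter> space M |C. C \<in> sets borel}"
      proof safe
        fix C :: "real set" assume "C \<in> sets borel"
        then have "k -` C \<in> sets borel" using measurable_sets[OF k, of C] by simp
        moreover have "(\<lambda>\<omega>. k (Y \<omega>)) -` C \<inter> space M = Y -` (k -` C) \<inter> space M" by auto
        ultimately show "\<exists>C'. (\<lambda>\<omega>. k (Y \<omega>)) -` C \<inter> space M = Y -` C' \<inter> space M \<and> C' \<in> sets borel"
          by blast
      qed
      finally show ?thesis .
    qed
    show ?thesis
      unfolding indep_var_eq
    proof (intro conjI)
      show "random_variable borel (\<lambda>\<omega>. ?z \<omega> $ i * ?z \<omega> $ j)" by (rule measurable_compose[OF meas_z g])
      show "random_variable borel (\<lambda>\<omega>. ?B \<omega> $ i $ j)" by (rule measurable_poly_matrix_entry)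
      show "indep_set
         (sigma_sets (space M) {(\<lambda>\<omega>. ?z \<omega> $ i * ?z \<omega> $ j) -` A \<inter> space M |A. A \<in> sets borel})
         (sigma_sets (space M) {(\<lambda>\<omega>. ?B \<omega> $ i $ j) -` A \<inter> space M |A. A \<in> sets borel})"
        using indep unfolding indep_set_def
        by (rule indep_sets_mono_sets) (use sub[OF meas_z g] sub[OF measurable_H h] in \<open>auto split: bool.split\<close>)
    qed
  qed
  have "has_bochner_integral M (\<lambda>\<omega>. ?z \<omega> $ i * ?z \<omega> $ j * ?B \<omega> $ i $ j)
      ((if i = j then 1 else 0) * (\<integral>\<omega>. ?B \<omega> $ i $ j \<partial>M))" for i j
    using indep_var_integrable[OF indep_zB _ int_B] indep_var_lebesgue_integral[OF indep_zB _ int_B] zz[of i j]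
    by (simp add: has_bochner_integral_iff)
  then have "has_bochner_integral M (\<lambda>\<omega>. \<Sum>i\<in>UNIV. \<Sum>j\<in>UNIV. ?z \<omega> $ i * ?z \<omega> $ j * ?B \<omega> $ i $ j)
      (\<Sum>i\<in>UNIV. \<Sum>j\<in>UNIV. (if i = j then 1 else 0) * (\<integral>\<omega>. ?B \<omega> $ i $ j \<partial>M))"
    by (intro has_bochner_integral_sum)
  moreover have "?z \<omega> \<bullet> (?B \<omega> *v ?z \<omega>) = (\<Sum>i\<in>UNIV. \<Sum>j\<in>UNIV. ?z \<omega> $ i * ?z \<omega> $ j * ?B \<omega> $ i $ j)" for \<omega>
    by (simp add: inner_vec_def matrix_vector_mult_def sum_distrib_left mult_ac)
  moreover have "(\<Sum>i\<in>UNIV. \<Sum>j\<in>UNIV. (if i = j then 1 else 0) * (\<integral>\<omega>. ?B \<omega> $ i $ j \<partial>M))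
      = (\<integral>\<omega>. trace (?B \<omega>) \<partial>M)"
    unfolding trace_def
    by (subst Bochner_Integration.integral_sum)
      (simp_all add: int_B if_distrib[of "\<lambda>c. c * _"] cong: if_cong)
  ultimately show ?thesis
    using expectation_trace_poly_matrix[OF assms] by (simp add: has_bochner_integral_iff)
qed

end

section \<open>Optimal rates\<close>

context random_quadratic_problem
begin

text \<open>The power is kept as \<open>x ^ 1\<close> to match the pattern \<open>x ^ k\<close>
  shared by both criteria.\<close>

lemma expected_gap_eq:
  assumes ae: "AE x in expected_spectral_distribution M H. x \<in> {0<..L}"
  shows "expected_gap M H x0 xs c t = CARD('n) / 2 *
    (\<integral>x. x ^ 1 * (poly (residual_poly c t) x)\<^sup>2 \<partial>expected_spectral_distribution M H)"
proof -
  let ?q = "monom 1 1 * (residual_poly c t)\<^sup>2" and ?z = "\<lambda>\<omega>. x0 \<omega> - xs \<omega>"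
  have "quadratic (H \<omega>) (xs \<omega>) (iterate c (quadratic (H \<omega>) (xs \<omega>)) (x0 \<omega>) t)
         - quadratic (H \<omega>) (xs \<omega>) (xs \<omega>) = (1 / 2) * (?z \<omega> \<bullet> (poly_matrix ?q (H \<omega>) *v ?z \<omega>))"
    if \<omega>: "\<omega> \<in> space M" for \<omega>
  proof -
    have sym: "transpose (H \<omega>) = H \<omega>" using sym_pos_def_H[OF \<omega>] by (simp add: sym_pos_def_def)
    obtain f e where "orthonormal_eigenbasis (H \<omega>) f e"
      using sym_pos_def_orthonormal_eigenbasis[OF sym_pos_def_H[OF \<omega>]] by blast
    then interpret orthonormal_eigenbasis "H \<omega>" f e .
    show ?thesis by (rule quadratic_gap_eq[OF iterate_eq[OF sym]])
  qed
  then have "expected_gap M H x0 xs c t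
      = (\<integral>\<omega>. (1 / 2) * (?z \<omega> \<bullet> (poly_matrix ?q (H \<omega>) *v ?z \<omega>)) \<partial>M)"
    unfolding expected_gap_def by (intro Bochner_Integration.integral_cong) auto
  then show ?thesis
    using expectation_quadratic_form[OF ae, of ?q] by (simp add: poly_monom)
qed

lemma expected_sq_grad_eq:
  assumes ae: "AE x in expected_spectral_distribution M H. x \<in> {0<..L}"
  shows "expected_sq_grad M H x0 xs c t = CARD('n) *
    (\<integral>x. x ^ 2 * (poly (residual_poly c t) x)\<^sup>2 \<partial>expected_spectral_distribution M H)"
proof -
  let ?q = "monom 1 2 * (residual_poly c t)\<^sup>2" and ?z = "\<lambda>\<omega>. x0 \<omega> - xs \<omega>"
  have "(norm (gradient (quadratic (H \<omega>) (xs \<omega>)) (iterate c (quadratic (H \<omega>) (xs \<omega>)) (x0 \<omega>) t)))\<^sup>2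
      = ?z \<omega> \<bullet> (poly_matrix ?q (H \<omega>) *v ?z \<omega>)"
    if \<omega>: "\<omega> \<in> space M" for \<omega>
  proof -
    have sym: "transpose (H \<omega>) = H \<omega>" using sym_pos_def_H[OF \<omega>] by (simp add: sym_pos_def_def)
    obtain f e where "orthonormal_eigenbasis (H \<omega>) f e"
      using sym_pos_def_orthonormal_eigenbasis[OF sym_pos_def_H[OF \<omega>]] by blast
    then interpret orthonormal_eigenbasis "H \<omega>" f e .
    show ?thesis by (rule sq_norm_gradient_eq[OF sym iterate_eq[OF sym]])
  qed
  then have "expected_sq_grad M H x0 xs c t
      = (\<integral>\<omega>. ?z \<omega> \<bullet> (poly_matrix ?q (H \<omega>) *v ?z \<omega>) \<partial>M)"
    unfolding expected_sq_grad_def by (intro Bochner_Integration.integral_cong) auto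
  then show ?thesis
    using expectation_quadratic_form[OF ae, of ?q] by (simp add: poly_monom)
qed

end

lemma generalized_chebyshev_method_residual_poly:
  assumes "shifted_jacobi L \<alpha> \<beta> (residual_poly c)"
  shows "generalized_chebyshev_method TYPE('n::finite) L \<alpha> \<beta> c"
  unfolding generalized_chebyshev_method_def
proof (intro exI[of _ "residual_poly c"] conjI assms allI impI)
  fix A :: "real ^ 'n ^ 'n" and ys y0 t
  assume A: "sym_pos_def A"
  then have sym: "transpose A = A" by (simp add: sym_pos_def_def)
  obtain f e where "orthonormal_eigenbasis A f e"
    using sym_pos_def_orthonormal_eigenbasis[OF A] by blast
  then interpret orthonormal_eigenbasis A f e .
  show "iterate c (quadratic A ys) y0 t - ys = poly_matrix (residual_poly c t) A *v (y0 - ys)"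
    by (rule iterate_eq[OF sym])
qed

text \<open>The two criteria differ only in \<open>k\<close> and a positive factor, so both are
  treated at once through \<open>G\<close>. The uniform lower bound passes to the infimum, and the
  Chebyshev coefficients bound it from above.\<close>

lemma optimal_residual_rate:
  fixes G :: "(nat \<Rightarrow> nat \<Rightarrow> real) \<Rightarrow> nat \<Rightarrow> real"
  assumes edge: "edge_distribution L \<tau> \<xi> \<nu>" and L: "0 < L" and \<tau>: "-1 < \<tau>" and \<xi>: "-1 < \<xi>" and k: "1 \<le> k"
    and K: "0 < K" and G: "\<And>c t. G c t = K * (\<integral>x. x ^ k * (poly (residual_poly c t) x)\<^sup>2 \<partial>\<nu>)"
  shows "(\<lambda>t. INF c. G c t) \<in> \<Theta>(\<lambda>t. real t powr (-2 * (\<xi> + k + 1)))"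
    and "\<exists>c. generalized_chebyshev_method TYPE('n::finite) L \<tau> (\<xi> + k + 1) c
           \<and> G c \<in> \<Theta>(\<lambda>t. real t powr (-2 * (\<xi> + k + 1)))"
proof -
  let ?r = "\<lambda>t. real t powr (-2 * (\<xi> + k + 1))"
  have ae: "AE x in \<nu>. x \<in> {0<..L}" using edge by (simp add: edge_distribution_def)
  have G_nonneg: "0 \<le> G c t" for c t
    unfolding G using K ae
    by (intro mult_nonneg_nonneg integral_nonneg_AE) (auto elim: eventually_mono)
  \<comment> \<open>An infimum of reals is a lower bound only for sets bounded below; nonnegativity
    supplies this.\<close>
  have bdd: "bdd_below (range (\<lambda>c. G c t))" for t
    using G_nonneg by (intro bdd_belowI[of _ 0]) auto
  obtain C where C: "0 < C" "eventually (\<lambda>t. \<forall>p. degree p \<le> t \<longrightarrow> poly p 0 = 1 \<longrightarrow>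
      C * ?r t \<le> (\<integral>x. x ^ k * (poly p x)\<^sup>2 \<partial>\<nu>)) sequentially"
    using edge_distribution_residual_lower_bound[OF edge L \<xi> k] by blast
  have lower: "eventually (\<lambda>t. \<forall>c. (K * C) * ?r t \<le> G c t) sequentially"
    using C(2)
  proof eventually_elim
    case (elim t)
    show ?case
    proof
      fix c
      have "C * ?r t \<le> (\<integral>x. x ^ k * (poly (residual_poly c t) x)\<^sup>2 \<partial>\<nu>)"
        using elim degree_residual_poly_le poly_residual_poly_0 by blast
      then show "(K * C) * ?r t \<le> G c t"
        unfolding G mult.assoc using K by (intro mult_left_mono) auto
    qed
  qed
  have "-1 < \<xi> + k + 1" using \<xi> by simp
  note jacobi = shifted_jacobi_jacobi_poly[OF L \<tau> this]
  obtain c where c: "residual_poly c = jacobi_poly L \<tau> (\<xi> + k + 1)"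
    using residual_poly_surj[of "jacobi_poly L \<tau> (\<xi> + k + 1)"] jacobi by (auto simp: shifted_jacobi_def)
  have G_upper: "G c \<in> O(?r)"
    using edge_distribution_jacobi_upper_bound[OF edge L \<tau> \<xi> k] K
    unfolding G[abs_def] c by simp
  have "G c \<in> \<Omega>(?r)"
    using lower K C(1) G_nonneg
    by (intro landau_omega.bigI[of "K * C"]) (auto elim!: eventually_mono)
  with G_upper have "G c \<in> \<Theta>(?r)" by (rule bigthetaI)
  moreover have "generalized_chebyshev_method TYPE('n) L \<tau> (\<xi> + k + 1) c"
    using jacobi by (intro generalized_chebyshev_method_residual_poly) (simp add: c)
  ultimately show "\<exists>c. generalized_chebyshev_method TYPE('n) L \<tau> (\<xi> + k + 1) c \<and> G c \<in> \<Theta>(?r)"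
    by blast
  have INF_nonneg: "0 \<le> (INF c. G c t)" for t by (intro cINF_greatest G_nonneg) auto
  have "(\<lambda>t. INF c. G c t) \<in> O(G c)"
  proof (rule bigoI[of _ 1], rule always_eventually, rule allI)
    fix t
    have "(INF c. G c t) \<le> G c t" by (intro cINF_lower bdd) auto
    then show "norm (INF c. G c t) \<le> 1 * norm (G c t)" using INF_nonneg[of t] by simp
  qed
  also note G_upper
  finally have "(\<lambda>t. INF c. G c t) \<in> O(?r)" .
  moreover have "(\<lambda>t. INF c. G c t) \<in> \<Omega>(?r)"
  proof (rule landau_omega.bigI[of "K * C"])
    show "0 < K * C" using K C(1) by simp
    show "eventually (\<lambda>t. norm (INF c. G c t) \<ge> K * C * norm (?r t)) sequentially"
      using lower
    proof eventually_elim
      case (elim t)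
      then have "K * C * ?r t \<le> (INF c. G c t)" by (intro cINF_greatest) auto
      then show ?case using INF_nonneg[of t] by simp
    qed
  qed
  ultimately show "(\<lambda>t. INF c. G c t) \<in> \<Theta>(?r)" by (rule bigthetaI)
qed

theorem theorem4p2:
  fixes M :: "'w measure"
    and H :: "'w \<Rightarrow> real ^ 'n ^ 'n" and x0 xs :: "'w \<Rightarrow> real ^ 'n"
    and L \<tau> \<xi> :: real and \<nu> :: "real measure"
  assumes "0 < L" and "-1 < \<tau>" and "-1 < \<xi>"
    and "edge_distribution L \<tau> \<xi> \<nu>"
    and "random_quadratic_problem M H x0 xs"
    and "expected_spectral_distribution M H = \<nu>"
  shows "((\<lambda>t. INF c. expected_gap M H x0 xs c t) \<in> \<Theta>(\<lambda>t. real t powr (-2 * (\<xi> + 2)))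
          \<and> (\<exists>c. generalized_chebyshev_method TYPE('n) L \<tau> (\<xi> + 2) c
                \<and> expected_gap M H x0 xs c \<in> \<Theta>(\<lambda>t. real t powr (-2 * (\<xi> + 2)))))
       \<and> ((\<lambda>t. INF c. expected_sq_grad M H x0 xs c t) \<in> \<Theta>(\<lambda>t. real t powr (-2 * (\<xi> + 3)))
          \<and> (\<exists>c. generalized_chebyshev_method TYPE('n) L \<tau> (\<xi> + 3) c
                \<and> expected_sq_grad M H x0 xs c \<in> \<Theta>(\<lambda>t. real t powr (-2 * (\<xi> + 3)))))"
proof -
  interpret random_quadratic_problem M H x0 xs by (rule assms(5))
  have ae: "AE x in expected_spectral_distribution M H. x \<in> {0<..L}"
    using assms(4) unfolding assms(6) by (simp add: edge_distribution_def)
  note gap = expected_gap_eq[OF ae, unfolded assms(6)]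
    and sq_grad = expected_sq_grad_eq[OF ae, unfolded assms(6)]
  have exponents: "\<xi> + real 1 + 1 = \<xi> + 2" "\<xi> + real 2 + 1 = \<xi> + 3" by simp_all
  show ?thesis
    using optimal_residual_rate(1)[OF assms(4,1,2,3) _ _ gap] optimal_residual_rate(1)[OF assms(4,1,2,3) _ _ sq_grad]
      optimal_residual_rate(2)[OF assms(4,1,2,3) _ _ gap, where 'n = 'n]
      optimal_residual_rate(2)[OF assms(4,1,2,3) _ _ sq_grad, where 'n = 'n]
    unfolding exponents by simp
qed

end
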